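(* Let $I \subseteq \mathbb{R}$ be an open interval, let $$P(t)(x) = x^n + \sum_{j=1}^n (-1)^j a_j(t)\, x^{n-j}, \qquad t\in I,$$ be a curve of hyperbolic polynomials (not necessarily definable) with $E^{(\infty)}(P)=\emptyset$, let $J\subseteq I$ be a compact subinterval, and let $p\in\mathbb{N}_{>0}$. If the coefficients $a_j$ of $P$ are $C^{p+\Gamma_J(P)}$, then the roots of $P$ can be parameterized by $C^p$ functions globally near $J$, i.e. there are an open interval $I'$ with $J\subseteq I'\subseteq I$ and $C^p$ functions $\lambda_1,\dots,\lambda_n:I'\to\mathbb{R}$ with $P(t)(x)=\prod_{j=1}^n(x-\lambda_j(t))$ for all $t\in I'$.
   Context: A monic real polynomial is hyperbolic if all its roots are real; curves of polynomials have continuous coefficients. Multiplicity: for a continuous function $f$ defined near $t_0\in\mathbb{R}$, $m_{t_0}(f)\in\mathbb{N}\cup\{\infty\}$ is the supremum of all integers $q$ such that $f(t)=(t-t_0)^q g(t)$ near $t_0$ with $g$ continuous. For a monic polynomial $P$ of degree $n$ with roots $\lambda_1,\dots,\lambda_n$ (with multiplicity) and $1\le k\le n$ let $\tilde\Delta_k(P):=\sum_{i_1<\dots<i_k}\prod_{1\le a<b\le k}(\lambda_{i_a}-\lambda_{i_b})^2$, a polynomial in the coefficients of $P$ ($\tilde\Delta_1=n$). For a curve $P$, $E^{(\infty)}(P)$ is the set of all $t\in I$ such that, with $s$ maximal with the property that the germ at $t$ of $\tilde\Delta_s\circ P$ is not $0$, one has $m_t(\tilde\Delta_s\circ P)=\infty$.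 Definition of $\Gamma_{t_0}(P)$ (together with $\gamma_{t_0}(P)$), recursively, for a curve $P$ of monic hyperbolic polynomials defined near $t_0$: (I) If $P(t_0)$ has at least two distinct roots, factor $P(t)=P_1(t)P_2(t)$ near $t_0$ into curves of monic hyperbolic polynomials of positive degree with continuous coefficients (as regular as those of $P$) such that $P_1(t_0)$ and $P_2(t_0)$ have no common root, and set $\Gamma_{t_0}(P):=\max\{\Gamma_{t_0}(P_1),\Gamma_{t_0}(P_2)\}$ and $\gamma_{t_0}(P):=\Gamma_{t_0}(P)-\max\{\Gamma_{t_0}(P_1)-\gamma_{t_0}(P_1),\ \Gamma_{t_0}(P_2)-\gamma_{t_0}(P_2)\}$. (II) If $\deg P=n>1$ and all roots of $P(t_0)$ coincide, first replace $P(t)(x)$ by $P(t)(x+a_1(t)/n)$, so that $a_1=0$ identically (this by definition does not change $\Gamma_{t_0},\gamma_{t_0}$). If then $m_{t_0}(a_2)=2r<\infty$, write $a_k(t)=(t-t_0)^{kr}a_{(r),k}(t)$ with continuous $a_{(r),k}$, $2\le k\le n$, where $a_{(r),2}(t_0)\neq 0$, put $P_{(r)}(t)(x):=x^n+\sum_{k=2}^n(-1)^k a_{(r),k}(t)x^{n-k}$, and set $\Gamma_{t_0}(P):=\Gamma_{t_0}(P_{(r)})+n r$ and $\gamma_{t_0}(P):=\gamma_{t_0}(P_{(r)})+r$. If $m_{t_0}(a_2)=\infty$, set $\Gamma_{t_0}(P):=\gamma_{t_0}(P):=0$. (III) If $\deg P=1$, set $\Gamma_{t_0}(P):=\gamma_{t_0}(P):=0$.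 These integers are defined whenever the coefficients are differentiable enough for every step of the recursion to be possible; it suffices that the coefficients are $C^{\Gamma_{t_0}(P)+1}$ near $t_0$. The hypothesis that the $a_j$ are $C^{p+\Gamma_J(P)}$ includes that the recursion can be carried out at every $t_0\in J$. Put $\Gamma_J(P):=\sup\{\Gamma_{t_0}(P):t_0\in J\}\in\mathbb{N}\cup\{+\infty\}$, with $C^{p+\infty}:=C^\infty$. *)

theory Defs
  imports "HOL-Analysis.Analysis" "HOL-Computational_Algebra.Computational_Algebra"
begin

section \<open>Differentiability classes and multiplicity\<close>

text \<open>
  Class $C^k$ on an open set, for $k \in \mathbb{N} \cup \{\infty\}$. On an open set the iterates of
  \<^const>\<open>deriv\<close> are the usual higher derivatives; \<open>C_on\<close> is only used for open sets.
\<close>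

definition C_on :: "enat \<Rightarrow> (real \<Rightarrow> real) \<Rightarrow> real set \<Rightarrow> bool" where
  "C_on k f U \<longleftrightarrow>
     (\<forall>j. enat j \<le> k \<longrightarrow> continuous_on U ((deriv ^^ j) f)) \<and>
     (\<forall>j. enat j < k \<longrightarrow> (deriv ^^ j) f differentiable_on U)"

definition multiplicity_at :: "real \<Rightarrow> (real \<Rightarrow> real) \<Rightarrow> enat" where
  "multiplicity_at t0 f =
     Sup {enat q | q. \<exists>U g. open U \<and> t0 \<in> U \<and> continuous_on U g \<and>
                            (\<forall>t\<in>U. f t = (t - t0) ^ q * g t)}"


section \<open>Curves of monic hyperbolic polynomials\<close>

definition hyperbolic :: "real poly \<Rightarrow> bool" where
  "hyperbolic p \<longleftrightarrow> lead_coeff p = 1 \<and>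
     (\<forall>z::complex. poly (map_poly of_real p) z = 0 \<longrightarrow> z \<in> \<real>)"

definition hyperbolic_curve_on :: "real set \<Rightarrow> nat \<Rightarrow> (real \<Rightarrow> real poly) \<Rightarrow> bool" where
  "hyperbolic_curve_on U n P \<longleftrightarrow>
     (\<forall>t\<in>U. hyperbolic (P t) \<and> degree (P t) = n) \<and>
     (\<forall>i. continuous_on U (\<lambda>t. coeff (P t) i))"

definition hyperbolic_curve_near :: "real \<Rightarrow> nat \<Rightarrow> (real \<Rightarrow> real poly) \<Rightarrow> bool" where
  "hyperbolic_curve_near t0 n P \<longleftrightarrow> (\<exists>U. open U \<and> t0 \<in> U \<and> hyperbolic_curve_on U n P)"

text \<open>\<open>signed_coeff p k\<close> is the $a_k$ in $p = x^n + \sum_{k=1}^n (-1)^k a_k x^{n-k}$.\<close>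

definition signed_coeff :: "real poly \<Rightarrow> nat \<Rightarrow> real" where
  "signed_coeff p k = (-1) ^ k * coeff p (degree p - k)"

definition C_coeffs_near :: "enat \<Rightarrow> real \<Rightarrow> (real \<Rightarrow> real poly) \<Rightarrow> bool" where
  "C_coeffs_near k t0 P \<longleftrightarrow>
     (\<exists>U. open U \<and> t0 \<in> U \<and> (\<forall>i. C_on k (\<lambda>t. coeff (P t) i) U))"


section \<open>The polynomials $\tilde\Delta_k$ and the set $E^{(\infty)}$\<close>

text \<open>
  \<^const>\<open>proots\<close> collects the real roots with multiplicity. For a hyperbolic polynomial these are
  all the roots, and \<open>Delta_tilde\<close> is applied to such polynomials only. The
  value is symmetric in the roots, so the order in which they are listed does not matter.
\<close>

definition Delta_tilde :: "nat \<Rightarrow> real poly \<Rightarrow> real" where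
  "Delta_tilde k p =
     (let xs = sorted_list_of_multiset (proots p) in
        \<Sum>S | S \<subseteq> {..<length xs} \<and> card S = k.
          \<Prod>(i, j) | i \<in> S \<and> j \<in> S \<and> i < j. (xs ! i - xs ! j)\<^sup>2)"

definition E_infinity :: "real set \<Rightarrow> (real \<Rightarrow> real poly) \<Rightarrow> real set" where
  "E_infinity I P =
     {t \<in> I. \<exists>s \<in> {1..degree (P t)}.
        \<not> (\<forall>\<^sub>F u in nhds t. Delta_tilde s (P u) = 0) \<and>
        (\<forall>k \<in> {s<..degree (P t)}. \<forall>\<^sub>F u in nhds t. Delta_tilde k (P u) = 0) \<and>
        multiplicity_at t (\<lambda>u. Delta_tilde s (P u)) = \<infinity>}"


section \<open>The integers $\Gamma_{t_0}(P)$ and $\gamma_{t_0}(P)$\<close>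

text \<open>The substitution $x \mapsto x + a_1/n$, which makes the coefficient $a_1$ vanish.\<close>

definition centre :: "real poly \<Rightarrow> real poly" where
  "centre p = pcompose p [:signed_coeff p 1 / real (degree p), 1:]"

text \<open>
  \<open>Gamma_gamma t0 P G g\<close> means that the recursion can be carried out at \<open>t0\<close>, with
  $\Gamma_{t_0}(P) = G$ and $\gamma_{t_0}(P) = g$. It depends only on the germ of \<open>P\<close> at \<open>t0\<close>. The
  subtractions on \<^typ>\<open>nat\<close> do not truncate, as $\gamma_{t_0} \le \Gamma_{t_0}$ throughout.
\<close>

inductive Gamma_gamma :: "real \<Rightarrow> (real \<Rightarrow> real poly) \<Rightarrow> nat \<Rightarrow> nat \<Rightarrow> bool" for t0 :: real where
  split:
  "\<lbrakk> hyperbolic_curve_near t0 n P;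
     \<exists>x y. x \<noteq> y \<and> poly (P t0) x = 0 \<and> poly (P t0) y = 0;
     n1 > 0; hyperbolic_curve_near t0 n1 P1;
     n2 > 0; hyperbolic_curve_near t0 n2 P2;
     \<forall>\<^sub>F t in nhds t0. P t = P1 t * P2 t;
     \<forall>k. C_coeffs_near k t0 P \<longrightarrow> C_coeffs_near k t0 P1 \<and> C_coeffs_near k t0 P2;
     \<not> (\<exists>x. poly (P1 t0) x = 0 \<and> poly (P2 t0) x = 0);
     Gamma_gamma t0 P1 G1 g1; Gamma_gamma t0 P2 G2 g2;
     G = max G1 G2 \<rbrakk>
   \<Longrightarrow> Gamma_gamma t0 P G (G - max (G1 - g1) (G2 - g2))"
| rescale:
  "\<lbrakk> hyperbolic_curve_near t0 n P; n > 1;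
     \<forall>x y. poly (P t0) x = 0 \<longrightarrow> poly (P t0) y = 0 \<longrightarrow> x = y;
     multiplicity_at t0 (\<lambda>t. signed_coeff (centre (P t)) 2) = enat (2 * r);
     open U; t0 \<in> U;
     \<forall>k \<in> {2..n}. continuous_on U (b k) \<and>
        (\<forall>t\<in>U. signed_coeff (centre (P t)) k = (t - t0) ^ (k * r) * b k t);
     b 2 t0 \<noteq> 0;
     Gamma_gamma t0 (\<lambda>t. monom 1 n + (\<Sum>k=2..n. monom ((-1) ^ k * b k t) (n - k))) G g \<rbrakk>
   \<Longrightarrow> Gamma_gamma t0 P (G + n * r) (g + r)"
| flat:
  "\<lbrakk> hyperbolic_curve_near t0 n P; n > 1;
     \<forall>x y. poly (P t0) x = 0 \<longrightarrow> poly (P t0) y = 0 \<longrightarrow> x = y;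
     multiplicity_at t0 (\<lambda>t. signed_coeff (centre (P t)) 2) = \<infinity> \<rbrakk>
   \<Longrightarrow> Gamma_gamma t0 P 0 0"
| linear:
  "hyperbolic_curve_near t0 1 P \<Longrightarrow> Gamma_gamma t0 P 0 0"

definition Gamma_defined_at :: "real \<Rightarrow> (real \<Rightarrow> real poly) \<Rightarrow> bool" where
  "Gamma_defined_at t0 P \<longleftrightarrow> (\<exists>G g. Gamma_gamma t0 P G g)"

text \<open>
  The recursion yields at most one value at each \<open>t0\<close>, so this is
  $\sup \{\Gamma_{t_0}(P) : t_0 \in J\}$.
\<close>

definition Gamma_on :: "real set \<Rightarrow> (real \<Rightarrow> real poly) \<Rightarrow> enat" where
  "Gamma_on J P = Sup {enat G | G t0. t0 \<in> J \<and> (\<exists>g. Gamma_gamma t0 P G g)}"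

end

theory Submission
  imports Defs
begin

text \<open>
  Near a single point \<open>t0\<close> the roots are found by induction along the recursion that defines
  $\Gamma_{t_0}$. Because the roots are only asked to be $C^p$, each step of the recursion costs
  no more than the derivatives that $\Gamma$ pays for. If $P = P_1 P_2$, the roots of $P_1$ and
  $P_2$ are put together. If $P$ is rescaled to $P_{(r)}$, the roots of $P$ are
  $a_1/n + (t - t_0)^r \mu_j(t)$ with $\mu_j$ the roots of $P_{(r)}$, and the coefficients of
  $P_{(r)}$ arise from those of $P$ by division by $(t - t_0)^{kr}$ with $k \le n$. Such a division
  costs $kr \le nr$ derivatives (\<open>C_on_divide_power\<close>), which is the summand $nr$ in $\Gamma$.

  The difficult case is the flat one, where the coefficient $a_2$ of the centred polynomial
  vanishes to infinite order. The common
  value $a_1/n$ of the roots at $t_0$ continues to parameterize them only if $a_2$ vanishes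
  identically near $t_0$. This is what $E^{(\infty)}(P) = \emptyset$ provides, but that condition
  concerns all of $P$ and says nothing about the factors met during the recursion. The induction
  therefore carries the number \<open>L\<close> of leaves of the recursion (\<open>root_dichotomy\<close>). Roots of
  one leaf differ by $O(|t - t_0|^N)$ for every $N$, so among more than \<open>L\<close> roots two are
  infinitely close. Different leaves have different roots at $t \ne t_0$, so there are at least \<open>L\<close>
  distinct roots. Finally, either there are $C^p$ roots near \<open>t0\<close>, or some flat leaf has several
  distinct roots at points arbitrarily close to \<open>t0\<close>, and there $P$ has more than \<open>L\<close>
  distinct roots. In this last case the largest $s$ for which $\tilde\Delta_s$ has a nonzero germ
  exceeds \<open>L\<close>. By the pigeonhole principle each summand of $\tilde\Delta_s$ contains a
  pair of infinitely close roots, and $\tilde\Delta_s$ is continuous since the ordered roots of a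
  hyperbolic curve are continuous (\<open>continuous_sorted_roots\<close>). So its multiplicity at \<open>t0\<close> is
  infinite, contrary to $E^{(\infty)}(P) = \emptyset$ (\<open>no_extra_roots\<close>).

  It follows in addition that each \<open>t0\<close> has a punctured neighbourhood in which the number of
  distinct roots is constant. At a point \<open>c\<close> near which this number is constant, distinct roots at
  \<open>c\<close> stay distinct and equal ones stay equal. Hence two root systems that agree at \<open>c\<close> up to order
  agree near \<open>c\<close> after one permutation, and gluing them at \<open>c\<close> produces no loss of smoothness
  (\<open>glue_C_roots\<close>). Compactness of \<open>J\<close> turns local roots into roots near \<open>J\<close>.
\<close>

section \<open>Calculus of $C^k$ functions\<close>

lemma C_on_zero_iff: "C_on (enat 0) f U \<longleftrightarrow> continuous_on U f"
  by (simp add: C_on_def)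

text \<open>
  Peeling off the first derivative is what makes all closure properties below provable by
  induction on the order.
\<close>

lemma C_on_Suc_iff:
  "C_on (enat (Suc k)) f U \<longleftrightarrow> f differentiable_on U \<and> C_on (enat k) (deriv f) U"
proof -
  have sw: "(deriv ^^ Suc j) f = (deriv ^^ j) (deriv f)" for j
    by (simp add: funpow_swap1)
  show ?thesis
  proof
    assume *: "C_on (enat (Suc k)) f U"
    have "(deriv ^^ 0) f differentiable_on U"
      using * unfolding C_on_def by (metis enat_ord_simps(2) zero_less_Suc)
    moreover have "continuous_on U ((deriv ^^ j) (deriv f))" if "j \<le> k" for j
      using * that unfolding C_on_def sw[symmetric] by auto
    moreover have "((deriv ^^ j) (deriv f)) differentiable_on U" if "j < k" for j
      using * that unfolding C_on_def sw[symmetric] by auto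
    ultimately show "f differentiable_on U \<and> C_on (enat k) (deriv f) U"
      by (simp add: C_on_def)
  next
    assume *: "f differentiable_on U \<and> C_on (enat k) (deriv f) U"
    have "continuous_on U ((deriv ^^ j) f)" if "j \<le> Suc k" for j
    proof (cases j)
      case 0
      then show ?thesis using * differentiable_imp_continuous_on by auto
    next
      case (Suc i)
      then show ?thesis using * that unfolding C_on_def Suc sw by auto
    qed
    moreover have "((deriv ^^ j) f) differentiable_on U" if "j < Suc k" for j
    proof (cases j)
      case 0
      then show ?thesis using * by auto
    next
      case (Suc i)
      then show ?thesis using * that unfolding C_on_def Suc sw by auto
    qed
    ultimately show "C_on (enat (Suc k)) f U"
      by (simp add: C_on_def)
  qed
qed

lemma C_on_mono: "C_on k f U \<Longrightarrow> k' \<le> k \<Longrightarrow> C_on k' f U"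
  unfolding C_on_def by (meson order_trans order_less_le_trans)

lemma C_on_subset: "C_on k f U \<Longrightarrow> V \<subseteq> U \<Longrightarrow> C_on k f V"
  unfolding C_on_def using continuous_on_subset differentiable_on_subset by blast

lemma C_on_imp_continuous_on: "C_on k f U \<Longrightarrow> continuous_on U f"
  unfolding C_on_def by (metis funpow_0 zero_enat_def zero_le)

lemma C_on_SucD:
  assumes "C_on (enat (Suc k)) f U" "open U" "x \<in> U"
  shows "(f has_real_derivative deriv f x) (at x)"
  using assms unfolding C_on_Suc_iff
  by (metis DERIV_deriv_iff_real_differentiable differentiable_on_eq_differentiable_at)

lemma C_on_cong:
  assumes "open U" "\<And>x. x \<in> U \<Longrightarrow> f x = g x" "C_on (enat k) f U"
  shows "C_on (enat k) g U"
  using assms(2,3)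
proof (induction k arbitrary: f g)
  case 0
  then show ?case using continuous_on_cong by (simp add: C_on_zero_iff)
next
  case (Suc k)
  have ev: "\<forall>\<^sub>F y in nhds x. f y = g y" if "x \<in> U" for x
    using Suc.prems(1) assms(1) that by (auto simp: eventually_nhds)
  have "deriv f x = deriv g x" if "x \<in> U" for x
    using deriv_cong_ev[OF ev[OF that] refl] .
  then have "C_on (enat k) (deriv g) U"
    using Suc.IH[of "deriv f" "deriv g"] Suc.prems(2) by (simp add: C_on_Suc_iff)
  moreover have "g differentiable_on U"
    using Suc.prems by (simp add: C_on_Suc_iff differentiable_on_def)
      (metis differentiable_transform_within zero_less_one)
  ultimately show ?case by (simp add: C_on_Suc_iff)
qed

lemma C_on_SucI:
  assumes U: "open U" and d: "\<And>x. x \<in> U \<Longrightarrow> (f has_real_derivative f' x) (at x)"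
    and "C_on (enat k) f' U"
  shows "C_on (enat (Suc k)) f U"
proof -
  have "f differentiable_on U"
    using d by (meson differentiable_at_imp_differentiable_on real_differentiable_def)
  moreover have "C_on (enat k) (deriv f) U"
    by (rule C_on_cong[OF U _ assms(3)]) (rule DERIV_imp_deriv[OF d, symmetric])
  ultimately show ?thesis by (simp add: C_on_Suc_iff)
qed

lemma C_on_locally:
  assumes "\<And>x. x \<in> U \<Longrightarrow> \<exists>V. open V \<and> x \<in> V \<and> C_on k f V"
  shows "C_on k f U"
proof -
  have "continuous_on U ((deriv ^^ j) f)" if "enat j \<le> k" for j
    unfolding continuous_on_eq_continuous_within
    using assms that unfolding C_on_def
    by (meson continuous_at_imp_continuous_within continuous_on_eq_continuous_at)
  moreover have "(deriv ^^ j) f differentiable_on U" if "enat j < k" for j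
    unfolding differentiable_on_def
    using assms that unfolding C_on_def
    by (meson differentiable_at_withinI differentiable_on_eq_differentiable_at)
  ultimately show ?thesis unfolding C_on_def by blast
qed

lemma C_on_const: "open U \<Longrightarrow> C_on (enat k) (\<lambda>x. c) U"
proof (induction k arbitrary: c)
  case (Suc k)
  then show ?case by (intro C_on_SucI[where f' = "\<lambda>_. 0"]) auto
qed (simp add: C_on_zero_iff)

lemma C_on_shift: "open U \<Longrightarrow> C_on (enat k) (\<lambda>x. x - c) U"
proof (cases k)
  case (Suc k)
  assume "open U"
  then show ?thesis unfolding Suc
    by (intro C_on_SucI[where f' = "\<lambda>_. 1"] C_on_const) (auto intro!: derivative_eq_intros)
qed (simp add: C_on_zero_iff continuous_intros)

lemma C_on_add:
  assumes U: "open U" and "C_on (enat k) f U" "C_on (enat k) g U"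
  shows "C_on (enat k) (\<lambda>x. f x + g x) U"
  using assms(2,3)
proof (induction k arbitrary: f g)
  case (Suc k)
  then have "C_on (enat k) (\<lambda>x. deriv f x + deriv g x) U"
    by (simp add: C_on_Suc_iff)
  moreover have "((\<lambda>x. f x + g x) has_real_derivative deriv f x + deriv g x) (at x)" if "x \<in> U" for x
    using C_on_SucD[OF Suc.prems(1) U that] C_on_SucD[OF Suc.prems(2) U that]
    by (rule DERIV_add)
  ultimately show ?case by (intro C_on_SucI[OF U])
qed (simp add: C_on_zero_iff continuous_intros)

lemma C_on_mult:
  assumes U: "open U" and "C_on (enat k) f U" "C_on (enat k) g U"
  shows "C_on (enat k) (\<lambda>x. f x * g x) U"
  using assms(2,3)
proof (induction k arbitrary: f g)
  case (Suc k)
  have "C_on (enat k) f U" "C_on (enat k) g U"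
    using Suc.prems by (auto intro: C_on_mono)
  then have "C_on (enat k) (\<lambda>x. deriv f x * g x + deriv g x * f x) U"
    using Suc by (intro C_on_add U Suc.IH) (simp_all add: C_on_Suc_iff)
  moreover have "((\<lambda>x. f x * g x) has_real_derivative deriv f x * g x + deriv g x * f x) (at x)"
    if "x \<in> U" for x
    using C_on_SucD[OF Suc.prems(1) U that] C_on_SucD[OF Suc.prems(2) U that]
    by (rule DERIV_mult)
  ultimately show ?case by (intro C_on_SucI[OF U])
qed (simp add: C_on_zero_iff continuous_intros)

lemma C_on_power:
  assumes "open U" "C_on (enat k) f U"
  shows "C_on (enat k) (\<lambda>x. f x ^ m) U"
  by (induction m) (auto intro: C_on_const C_on_mult assms)

lemma C_on_sum:
  assumes "open U" "\<And>i. i \<in> A \<Longrightarrow> C_on (enat k) (f i) U"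
  shows "C_on (enat k) (\<lambda>x. \<Sum>i\<in>A. f i x) U"
  using assms(2)
proof (induction A rule: infinite_finite_induct)
  case (insert x F)
  then show ?case by (simp add: C_on_add assms(1))
qed (auto intro: C_on_const assms)

text \<open>
  Differentiation under the integral sign turns the weight $s^j$ into $s^{j+1}$ and $g$ into $g'$,
  so the family of all these averages is closed under differentiation. The weight is there for the
  sake of this induction.
\<close>

lemma C_on_average:
  assumes U: "open U" "convex U" "t0 \<in> U" and "C_on (enat m) g U"
  shows "C_on (enat m) (\<lambda>t. integral {0..1} (\<lambda>s. s ^ j * g (t0 + s * (t - t0)))) U"
  using assms(4)
proof (induction m arbitrary: g j)
  have seg: "t0 + s * (t - t0) \<in> U" if "t \<in> U" "s \<in> {0..1}" for t s
  proof -
    have "(1 - s) *\<^sub>R t0 + s *\<^sub>R t \<in> U"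
      using convexD[OF U(2) U(3) that(1)] that(2) by auto
    then show ?thesis by (simp add: algebra_simps)
  qed
  have cont: "continuous_on (U \<times> {0..1}) (\<lambda>(t,s). s ^ j * g (t0 + s * (t - t0)))"
    if "continuous_on U g" for g j
  proof -
    have "continuous_on (U \<times> {0..1}) (\<lambda>z. g (t0 + snd z * (fst z - t0)))"
      by (rule continuous_on_compose2[OF that]) (auto intro!: continuous_intros simp: seg)
    then show ?thesis by (auto intro!: continuous_intros simp: case_prod_unfold)
  qed
  have cont_int: "continuous_on U (\<lambda>t. integral {0..1} (\<lambda>s. s ^ j * g (t0 + s * (t - t0))))"
    if "continuous_on U g" for g j
    using integral_continuous_on_param[of U 0 1 "\<lambda>t s. s ^ j * g (t0 + s * (t - t0))"]
      cont[OF that, of j] by simp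
  {
    case 0
    then show ?case using cont_int by (simp add: C_on_zero_iff)
  next
    case (Suc m)
    have cg: "continuous_on U g" and cdg: "continuous_on U (deriv g)"
      using Suc.prems C_on_imp_continuous_on differentiable_imp_continuous_on
      by (auto simp: C_on_Suc_iff)
    let ?F = "\<lambda>t. integral {0..1} (\<lambda>s. s ^ Suc j * deriv g (t0 + s * (t - t0)))"
    have "((\<lambda>t. integral {0..1} (\<lambda>s. s ^ j * g (t0 + s * (t - t0)))) has_real_derivative ?F t) (at t)"
      if t: "t \<in> U" for t
    proof -
      have "((\<lambda>t. integral (cbox 0 1) (\<lambda>s. s ^ j * g (t0 + s * (t - t0)))) has_real_derivative
          integral (cbox 0 1) (\<lambda>s. s ^ Suc j * deriv g (t0 + s * (t - t0)))) (at t within U)"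
      proof (rule leibniz_rule_field_derivative)
        fix x s assume x: "x \<in> U" "s \<in> cbox 0 (1::real)"
        have "(g has_real_derivative deriv g (t0 + s * (x - t0))) (at (t0 + s * (x - t0)))"
          using C_on_SucD[OF Suc.prems U(1) seg] x by auto
        then have "((\<lambda>x. g (t0 + s * (x - t0))) has_real_derivative deriv g (t0 + s * (x - t0)) * s) (at x within U)"
          by (rule DERIV_chain2) (auto intro!: derivative_eq_intros)
        then show "((\<lambda>x. s ^ j * g (t0 + s * (x - t0))) has_real_derivative
            s ^ Suc j * deriv g (t0 + s * (x - t0))) (at x within U)"
          by (auto intro!: derivative_eq_intros)
      next
        fix x assume x: "x \<in> U"
        have "continuous_on {0..1} (\<lambda>s. g (t0 + s * (x - t0)))"
          by (rule continuous_on_compose2[OF cg]) (auto intro!: continuous_intros simp: seg x)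
        then show "(\<lambda>s. s ^ j * g (t0 + s * (x - t0))) integrable_on cbox 0 1"
          by (intro integrable_continuous continuous_intros) simp
      next
        show "continuous_on (U \<times> cbox 0 1) (\<lambda>(x, s). s ^ Suc j * deriv g (t0 + s * (x - t0)))"
          using cont[OF cdg, of "Suc j"] by simp
      qed (use U t in auto)
      then show ?thesis using at_within_open[OF t U(1)] by simp
    qed
    moreover have "C_on (enat m) ?F U"
      using Suc by (intro Suc.IH) (simp add: C_on_Suc_iff)
    ultimately show ?case by (intro C_on_SucI[OF U(1)])
  }
qed

text \<open>
  Hadamard's lemma: $f(t) = (t - t_0) \int_0^1 f'(t_0 + s (t - t_0))\, ds$, so \<open>b\<close> is an average of
  $f'$, and division by $t - t_0$ costs exactly one derivative.
\<close>

lemma C_on_divide_linear: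
  assumes U: "open U" "convex U" "t0 \<in> U" and f: "C_on (enat (Suc m)) f U"
    and b: "continuous_on U b" and eq: "\<And>t. t \<in> U \<Longrightarrow> f t = (t - t0) * b t"
  shows "C_on (enat m) b U"
proof -
  let ?h = "\<lambda>t. integral {0..1} (\<lambda>s. s ^ 0 * deriv f (t0 + s * (t - t0)))"
  have h: "C_on (enat m) ?h U"
    using f by (intro C_on_average U) (simp add: C_on_Suc_iff)
  \<comment> \<open>Away from \<open>t0\<close> this is the fundamental theorem of calculus along the segment from \<open>t0\<close> to \<open>t\<close>.\<close>
  have off: "?h t = b t" if t: "t \<in> U" "t \<noteq> t0" for t
  proof -
    have seg: "t0 + s * (t - t0) \<in> U" if "s \<in> {0..1}" for s
    proof -
      have "(1 - s) *\<^sub>R t0 + s *\<^sub>R t \<in> U"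
        using convexD[OF U(2) U(3) t(1)] that by auto
      then show ?thesis by (simp add: algebra_simps)
    qed
    have "((\<lambda>s. (t - t0) * deriv f (t0 + s * (t - t0))) has_integral
        (f (t0 + 1 * (t - t0)) - f (t0 + 0 * (t - t0)))) {0..1}"
    proof (rule fundamental_theorem_of_calculus)
      fix s :: real assume s: "s \<in> {0..1}"
      have "(f has_real_derivative deriv f (t0 + s * (t - t0))) (at (t0 + s * (t - t0)))"
        using C_on_SucD[OF f U(1) seg[OF s]] .
      then have "((\<lambda>s. f (t0 + s * (t - t0))) has_real_derivative deriv f (t0 + s * (t - t0)) * (t - t0))
          (at s within {0..1})"
        by (rule DERIV_chain2) (auto intro!: derivative_eq_intros)
      then show "((\<lambda>s. f (t0 + s * (t - t0))) has_vector_derivative (t - t0) * deriv f (t0 + s * (t - t0)))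
          (at s within {0..1})"
        by (simp add: has_real_derivative_iff_has_vector_derivative mult.commute)
    qed simp
    then have "(t - t0) * ?h t = f t - f t0"
      using t by (simp add: has_integral_iff)
    then show ?thesis using eq[OF t(1)] eq[OF U(3)] t by simp
  qed
  have on: "?h t0 = b t0"
  proof -
    have "\<forall>\<^sub>F t in at t0. ?h t = b t"
      using off U(1,3) by (auto simp: eventually_at_topological)
    moreover have "(?h \<longlongrightarrow> ?h t0) (at t0)"
      using bspec[OF C_on_imp_continuous_on[OF h, unfolded continuous_on_eq_continuous_at[OF U(1)]] U(3)]
      unfolding isCont_def .
    moreover have "(b \<longlongrightarrow> b t0) (at t0)"
      using b U(1,3) by (simp add: continuous_on_eq_continuous_at isCont_def)
    ultimately show ?thesis
      using LIM_unique tendsto_cong[of ?h b "at t0" "?h t0"] by blast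
  qed
  show ?thesis
    by (rule C_on_cong[OF U(1) _ h]) (use on off in blast)
qed

lemma C_on_divide_power:
  assumes U: "open U" "convex U" "t0 \<in> U" and "C_on (enat (m + q)) f U"
    and b: "continuous_on U b" and "\<And>t. t \<in> U \<Longrightarrow> f t = (t - t0) ^ q * b t"
  shows "C_on (enat m) b U"
  using assms(4,6)
proof (induction q arbitrary: f)
  case 0
  then have "C_on (enat m) f U" "\<And>t. t \<in> U \<Longrightarrow> f t = b t" by simp_all
  then show ?case by (rule C_on_cong[OF U(1), rotated])
next
  case (Suc q)
  have "C_on (enat (m + q)) (\<lambda>t. (t - t0) ^ q * b t) U"
    by (rule C_on_divide_linear[OF U, of _ f])
      (use Suc.prems in \<open>auto intro!: continuous_intros b simp: algebra_simps\<close>)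
  then show ?case using Suc.IH by blast
qed

section \<open>Products of linear factors\<close>

definition linear_product :: "real list \<Rightarrow> real poly" where
  "linear_product xs = (\<Prod>x\<leftarrow>xs. [:- x, 1:])"

lemma linear_product_Nil [simp]: "linear_product [] = 1"
  by (simp add: linear_product_def)

lemma linear_product_Cons [simp]: "linear_product (x # xs) = [:- x, 1:] * linear_product xs"
  by (simp add: linear_product_def)

lemma linear_product_append: "linear_product (xs @ ys) = linear_product xs * linear_product ys"
  by (simp add: linear_product_def)

lemma poly_linear_product: "poly (linear_product xs) z = (\<Prod>x\<leftarrow>xs. z - x)"
  by (induction xs) (auto simp: algebra_simps)

lemma poly_linear_product_eq_0_iff: "poly (linear_product xs) z = 0 \<longleftrightarrow> z \<in> set xs"
  by (induction xs) auto

lemma linear_product_nonzero: "linear_product xs \<noteq> 0"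
  by (induction xs) (simp_all del: mult_pCons_left)

lemma degree_linear_product: "degree (linear_product xs) = length xs"
  by (induction xs) (simp_all add: degree_mult_eq linear_product_nonzero del: mult_pCons_left)

lemma proots_linear_product: "proots (linear_product xs) = mset xs"
proof (induction xs)
  case (Cons x xs)
  have "linear_product (x # xs) = [:- x, 1:] * linear_product xs" by simp
  then have "proots (linear_product (x # xs)) = proots [:- x, 1:] + proots (linear_product xs)"
    by (simp only:) (rule proots_mult, simp_all add: linear_product_nonzero)
  then show ?case using Cons by simp
qed simp

text \<open>
  Root lists may be reordered freely. This is used for sorting, and for matching two
  root systems at a point where they are glued.
\<close>

lemma linear_product_cong_mset: "mset xs = mset ys \<Longrightarrow> linear_product xs = linear_product ys"
  unfolding linear_product_def by (metis mset_map prod_mset_prod_list)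

lemma sorted_roots_linear_product:
  "sorted xs \<Longrightarrow> sorted_list_of_multiset (proots (linear_product xs)) = xs"
  by (simp add: proots_linear_product sorted_sort_id)

text \<open>
  The two top elementary symmetric functions, with $e_2$ expressed by Newton's identity through
  the power sums. For centred roots it says that $-2 a_2$ is the sum of their squares, which is how
  $a_2$ controls all roots.
\<close>

lemma top_coeffs_linear_product:
  "coeff (linear_product xs) (length xs) = 1"
  "length xs = Suc k \<Longrightarrow> coeff (linear_product xs) k = - sum_list xs"
  "length xs = Suc (Suc k) \<Longrightarrow>
     2 * coeff (linear_product xs) k = (sum_list xs)\<^sup>2 - (\<Sum>x\<leftarrow>xs. x\<^sup>2)"
proof (induction xs arbitrary: k)
  {
    case (Cons x xs)
    case 1
    then show ?case using Cons(1)
      by (simp add: coeff_eq_0 degree_linear_product)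
  next
    case (Cons x xs)
    case 2
    then show ?case using Cons(1) Cons(2)[of "k - 1"]
      by (cases k) (auto simp: coeff_pCons)
  next
    case (Cons x xs)
    case 3
    have k: "length xs = Suc k" using 3 by simp
    have s1: "coeff (linear_product xs) k = - sum_list xs" using Cons(2) k by blast
    show ?case
    proof (cases k)
      case 0
      then obtain y where "xs = [y]" using k by (cases xs) auto
      then show ?thesis by (simp add: 0 power2_eq_square algebra_simps)
    next
      case (Suc k')
      have "2 * coeff (linear_product xs) k' = (sum_list xs)\<^sup>2 - (\<Sum>x\<leftarrow>xs. x\<^sup>2)"
        using Cons(3) k Suc by blast
      then show ?thesis using s1 by (simp add: Suc power2_eq_square algebra_simps)
    qed
  }
qed auto

lemma poly_map_poly_of_real:
  "poly (map_poly of_real p) (of_real x :: complex) = of_real (poly p x)"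
  by (induction p) (simp_all add: map_poly_pCons)

lemma map_poly_of_real_mult:
  "map_poly of_real (p * q) = (map_poly of_real p * map_poly of_real q :: complex poly)"
  by (rule poly_eqI) (simp add: coeff_map_poly coeff_mult)

text \<open>
  By the fundamental theorem of algebra there is a complex root. It is real by hyperbolicity, and
  the quotient by its linear factor is hyperbolic again.
\<close>

lemma hyperbolic_imp_linear_product:
  assumes "hyperbolic p"
  shows "\<exists>xs. p = linear_product xs"
  using assms
proof (induction "degree p" arbitrary: p)
  case 0
  then have "p = 1"
    unfolding hyperbolic_def by (metis degree_eq_zeroE coeff_pCons_0 degree_pCons_0 one_pCons)
  then have "p = linear_product []" by simp
  then show ?case by blast
next
  case (Suc d)
  let ?c = "map_poly of_real :: real poly \<Rightarrow> complex poly"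
  have "degree (?c p) = Suc d"
    using Suc.hyps(2) by (simp add: degree_map_poly)
  then have "\<not> constant (poly (?c p))"
    by (metis constant_degree nat.distinct(1))
  then obtain z where z: "poly (?c p) z = 0"
    using fundamental_theorem_of_algebra by blast
  then obtain r where r: "z = of_real r"
    using Suc.prems unfolding hyperbolic_def by (metis Reals_cases)
  have "poly p r = 0"
    using z unfolding r poly_map_poly_of_real by simp
  then obtain q where q: "p = [:- r, 1:] * q"
    by (metis dvdE poly_eq_0_iff_dvd)
  have p0: "p \<noteq> 0" using Suc.prems by (auto simp: hyperbolic_def)
  then have "q \<noteq> 0" using q by auto
  then have "degree q = d"
    using Suc.hyps(2) unfolding q by (simp add: degree_mult_eq del: mult_pCons_left)
  moreover have "hyperbolic q"
    unfolding hyperbolic_def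
  proof (intro conjI allI impI)
    show "lead_coeff q = 1"
      using Suc.prems unfolding hyperbolic_def q by (simp only: lead_coeff_mult) simp
    fix w assume "poly (?c q) w = 0"
    then have "poly (?c p) w = 0"
      unfolding q map_poly_of_real_mult poly_mult by simp
    then show "w \<in> \<real>" using Suc.prems unfolding hyperbolic_def by blast
  qed
  ultimately obtain xs where "q = linear_product xs" using Suc.hyps(1) by blast
  then have "p = linear_product (r # xs)" using q by simp
  then show ?case by blast
qed

lemma pcompose_conv_sum:
  assumes "degree p \<le> n"
  shows "pcompose p q = (\<Sum>j\<le>n. smult (coeff p j) (q ^ j))"
proof -
  have "pcompose (monom c j) q = smult c (q ^ j)" for c j
    by (induction j) (simp_all add: monom_0 monom_Suc pcompose_pCons)
  then show ?thesis
    using pcompose_sum[of "\<lambda>j. monom (coeff p j) j" "{..n}" q] poly_as_sum_of_monoms'[OF assms]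
    by simp
qed

lemma pcompose_linear_product:
  "pcompose (linear_product xs) [:c, 1:] = linear_product (map (\<lambda>x. x - c) xs)"
  by (induction xs) (simp_all add: pcompose_1 pcompose_mult pcompose_pCons del: mult_pCons_left)

lemma coeff_linear_product_nonneg:
  fixes c :: real
  shows "\<forall>x\<in>set xs. x \<ge> c \<Longrightarrow> coeff (\<Prod>x\<leftarrow>xs. [:x - c, 1:]) i \<ge> 0"
  by (induction xs arbitrary: i) (auto simp: coeff_pCons split: nat.splits)

lemma coeff_linear_product_pos:
  fixes c :: real
  shows "\<forall>x\<in>set xs. x > c \<Longrightarrow> i \<le> length xs \<Longrightarrow> coeff (\<Prod>x\<leftarrow>xs. [:x - c, 1:]) i > 0"
proof (induction xs arbitrary: i)
  case (Cons x xs)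
  have nn: "coeff (\<Prod>x\<leftarrow>xs. [:x - c, 1:]) i \<ge> 0" for i
    using Cons.prems by (intro coeff_linear_product_nonneg) (auto intro: less_imp_le)
  show ?case
  proof (cases i)
    case 0
    then show ?thesis using Cons by simp
  next
    case (Suc j)
    then have "coeff (\<Prod>x\<leftarrow>xs. [:x - c, 1:]) j > 0" using Cons by simp
    moreover have "(x - c) * coeff (\<Prod>x\<leftarrow>xs. [:x - c, 1:]) i \<ge> 0"
      using Cons.prems nn by simp
    ultimately show ?thesis using Suc by simp
  qed
qed auto

lemma reflected_linear_product:
  "smult ((-1) ^ length xs) (pcompose (linear_product xs) [:c, -1:]) = (\<Prod>x\<leftarrow>xs. [:x - c, 1:])"
proof (induction xs)
  case (Cons x xs)
  have 1: "pcompose [:- x, 1:] [:c, -1:] = - [:x - c, 1:]"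
    by (simp add: pcompose_pCons)
  have "smult ((-1) ^ length (x # xs)) (pcompose (linear_product (x # xs)) [:c, -1:])
      = [:x - c, 1:] * smult ((-1) ^ length xs) (pcompose (linear_product xs) [:c, -1:])"
    unfolding linear_product_Cons pcompose_mult 1
    by (simp only: length_Cons power_Suc mult_minus_left mult_1 smult_minus_left smult_minus_right
        minus_minus mult_smult_right)
  then show ?case using Cons by simp
qed (simp add: pcompose_1)

section \<open>Continuity of the ordered roots\<close>

text \<open>
  The coefficients of $(-1)^n p(c - z) = \prod_i (z + x_i - c)$ are all positive if every root
  exceeds \<open>c\<close>. Conversely, positive coefficients exclude roots $z \ge 0$. This describes
  the position of the least root by strict inequalities between continuous functions.
\<close>

lemma all_roots_gt_iff:
  fixes xs :: "real list" and c :: real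
  shows "(\<forall>x\<in>set xs. x > c) \<longleftrightarrow>
    (\<forall>i\<le>length xs. (-1) ^ length xs * coeff (pcompose (linear_product xs) [:c, -1:]) i > 0)"
    (is "?L \<longleftrightarrow> ?R")
proof
  assume ?L
  then show ?R
    using coeff_linear_product_pos[of xs c] reflected_linear_product[of xs c]
    by (metis coeff_smult)
next
  assume R: ?R
  have "poly (linear_product xs) x \<noteq> 0" if "x \<le> c" for x
  proof -
    let ?Q = "pcompose (linear_product xs) [:c, -1:]"
    have d: "degree ?Q = length xs"
      by (simp add: degree_pcompose degree_linear_product)
    have "0 < (-1) ^ length xs * coeff ?Q 0" using R by blast
    then have "0 < (-1) ^ length xs * coeff ?Q 0 * (c - x) ^ 0" by simp
    also have "\<dots> \<le> (\<Sum>i\<le>length xs. (-1) ^ length xs * coeff ?Q i * (c - x) ^ i)"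
      by (rule member_le_sum) (use less_imp_le[OF R[rule_format]] that in \<open>auto intro!: mult_nonneg_nonneg\<close>)
    also have "\<dots> = (-1) ^ length xs * poly ?Q (c - x)"
      by (simp add: poly_altdef d sum_distrib_left mult.assoc)
    finally show ?thesis by (auto simp: poly_pcompose)
  qed
  then show ?L unfolding poly_linear_product_eq_0_iff by (meson linorder_not_le)
qed

text \<open>
  The analogue with weak inequalities, which describes a closed condition. Here the leading
  coefficient has to supply the positivity for $z > 0$.
\<close>

lemma all_roots_ge_iff:
  fixes xs :: "real list" and c :: real
  shows "(\<forall>x\<in>set xs. x \<ge> c) \<longleftrightarrow>
    (\<forall>i\<le>length xs. (-1) ^ length xs * coeff (pcompose (linear_product xs) [:c, -1:]) i \<ge> 0)"
    (is "?L \<longleftrightarrow> ?R")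
proof
  assume ?L
  then show ?R
    using coeff_linear_product_nonneg[of xs c] reflected_linear_product[of xs c]
    by (metis coeff_smult)
next
  assume R: ?R
  have "poly (linear_product xs) x \<noteq> 0" if "x < c" for x
  proof -
    let ?Q = "pcompose (linear_product xs) [:c, -1:]"
    have d: "degree ?Q = length xs"
      by (simp add: degree_pcompose degree_linear_product)
    have "(-1) ^ length xs * coeff ?Q (length xs) = (1::real)"
      using lead_coeff_comp[of "[:c, -1:]" "linear_product xs"]
      by (simp add: d degree_linear_product top_coeffs_linear_product flip: power_mult_distrib)
    then have "0 < (-1) ^ length xs * coeff ?Q (length xs) * (c - x) ^ length xs"
      using that by simp
    also have "\<dots> \<le> (\<Sum>i\<le>length xs. (-1) ^ length xs * coeff ?Q i * (c - x) ^ i)"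
      by (rule member_le_sum) (use R that in \<open>auto intro!: mult_nonneg_nonneg\<close>)
    also have "\<dots> = (-1) ^ length xs * poly ?Q (c - x)"
      by (simp add: poly_altdef d sum_distrib_left mult.assoc)
    finally show ?thesis by (auto simp: poly_pcompose)
  qed
  then show ?L unfolding poly_linear_product_eq_0_iff by (meson linorder_not_le)
qed

text \<open>
  Horner's scheme, read as a descending recursion for the coefficients of the quotient. It makes
  them continuous in the dividend and in the root that is divided off.
\<close>

lemma coeff_synthetic_div:
  "coeff (synthetic_div p c) i = coeff p (Suc i) + c * coeff (synthetic_div p c) (Suc i)"
proof -
  have "coeff (p + smult c (synthetic_div p c)) (Suc i)
      = coeff (pCons (poly p c) (synthetic_div p c)) (Suc i)"
    by (simp only: synthetic_div_correct)
  then show ?thesis by simp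
qed

lemma continuous_on_coeff_synthetic_div:
  fixes P :: "real \<Rightarrow> real poly"
  assumes "\<And>t. t \<in> U \<Longrightarrow> degree (P t) \<le> n"
    and P: "\<And>i. continuous_on U (\<lambda>t. coeff (P t) i)" and m: "continuous_on U m"
  shows "continuous_on U (\<lambda>t. coeff (synthetic_div (P t) (m t)) i)"
proof (induction "n - i" arbitrary: i)
  case 0
  have "coeff (synthetic_div (P t) (m t)) i = 0" if t: "t \<in> U" for t
  proof (cases "degree (P t) = 0")
    case True
    then show ?thesis by (metis synthetic_div_eq_0_iff coeff_0)
  next
    case False
    then show ?thesis
      using assms(1)[OF t] 0 by (intro coeff_eq_0) (simp add: degree_synthetic_div)
  qed
  then show ?case by (subst continuous_on_cong[OF refl, where g = "\<lambda>_. 0"]) auto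
next
  case (Suc d)
  have *: "continuous_on U (\<lambda>t. coeff (synthetic_div (P t) (m t)) (Suc i))"
    using Suc by (intro Suc.hyps(1)) simp
  have "continuous_on U (\<lambda>t. coeff (P t) (Suc i) + m t * coeff (synthetic_div (P t) (m t)) (Suc i))"
    by (intro continuous_on_add continuous_on_mult P m *)
  then show ?case by (simp only: coeff_synthetic_div[of _ _ i])
qed

text \<open>
  The preceding two characterizations make $\{m > y\}$ open and $\{m \ge y\}$ closed for every $y$.
\<close>

lemma continuous_on_least_root:
  fixes P :: "real \<Rightarrow> real poly"
  assumes P: "\<And>i. continuous_on U (\<lambda>t. coeff (P t) i)"
    and split: "\<And>t. t \<in> U \<Longrightarrow> \<exists>xs. length xs = n \<and> P t = linear_product xs"
    and m: "\<And>t. t \<in> U \<Longrightarrow> poly (P t) (m t) = 0"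
    and least: "\<And>t x. t \<in> U \<Longrightarrow> poly (P t) x = 0 \<Longrightarrow> m t \<le> x"
  shows "continuous_on U m"
  unfolding continuous_on
proof
  fix t0 assume t0: "t0 \<in> U"
  define c where "c i y t = (-1) ^ n * coeff (pcompose (P t) [:y, -1:]) i" for i y t
  have cont: "((c i y) \<longlongrightarrow> c i y t0) (at t0 within U)" for i y
  proof -
    have "continuous_on U (\<lambda>t. (-1) ^ n * (\<Sum>j\<le>n. coeff (P t) j * coeff ([:y, -1:] ^ j) i))"
      by (intro continuous_intros P)
    moreover have "(-1) ^ n * (\<Sum>j\<le>n. coeff (P t) j * coeff ([:y, -1:] ^ j) i) = c i y t" if "t \<in> U" for t
      using split[OF that] unfolding c_def
      by (subst pcompose_conv_sum[of _ n]) (auto simp: degree_linear_product coeff_sum)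
    ultimately have "continuous_on U (c i y)" by (simp cong: continuous_on_cong)
    then show ?thesis using t0 by (simp add: continuous_on)
  qed
  have gt: "m t > y \<longleftrightarrow> (\<forall>i\<le>n. c i y t > 0)" and ge: "m t \<ge> y \<longleftrightarrow> (\<forall>i\<le>n. c i y t \<ge> 0)"
    if t: "t \<in> U" for t y
  proof -
    obtain xs where xs: "length xs = n" "P t = linear_product xs" using split[OF t] by blast
    have "m t \<in> set xs" "\<forall>x\<in>set xs. m t \<le> x"
      using m[OF t] least[OF t] by (auto simp: xs poly_linear_product_eq_0_iff)
    then have "m t > y \<longleftrightarrow> (\<forall>x\<in>set xs. x > y)" "m t \<ge> y \<longleftrightarrow> (\<forall>x\<in>set xs. x \<ge> y)"
      by force+
    then show "m t > y \<longleftrightarrow> (\<forall>i\<le>n. c i y t > 0)" "m t \<ge> y \<longleftrightarrow> (\<forall>i\<le>n. c i y t \<ge> 0)"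
      unfolding all_roots_gt_iff all_roots_ge_iff c_def by (simp_all add: xs)
  qed
  have inU: "\<forall>\<^sub>F t in at t0 within U. t \<in> U"
    by (simp add: eventually_at_filter)
  show "(m \<longlongrightarrow> m t0) (at t0 within U)"
  proof (rule order_tendstoI)
    fix y assume "y < m t0"
    then have "\<forall>i\<le>n. c i y t0 > 0" using gt[OF t0] by simp
    then have "\<forall>i\<in>{..n}. \<forall>\<^sub>F t in at t0 within U. c i y t > 0"
      using order_tendstoD(1)[OF cont] by simp
    then have "\<forall>\<^sub>F t in at t0 within U. \<forall>i\<in>{..n}. c i y t > 0"
      by (simp add: eventually_ball_finite)
    then show "\<forall>\<^sub>F t in at t0 within U. y < m t"
      using inU by eventually_elim (simp add: gt)
  next
    fix y assume "m t0 < y"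
    then obtain i where i: "i \<le> n" "c i y t0 < 0" using ge[OF t0, of y] by (meson linorder_not_le)
    then have "\<forall>\<^sub>F t in at t0 within U. c i y t < 0"
      using order_tendstoD(2)[OF cont] by blast
    then show "\<forall>\<^sub>F t in at t0 within U. m t < y"
      using inU by eventually_elim (use ge i in \<open>meson linorder_not_le\<close>)
  qed
qed

text \<open>
  The least root is continuous. Dividing it off leaves a curve of the same kind of lower degree
  whose roots are not smaller, so repeating this lists the roots in increasing order.
\<close>

lemma continuous_sorted_roots:
  fixes P :: "real \<Rightarrow> real poly"
  assumes P: "\<And>i. continuous_on U (\<lambda>t. coeff (P t) i)"
    and "\<And>t. t \<in> U \<Longrightarrow> \<exists>xs. length xs = n \<and> P t = linear_product xs"
  shows "\<exists>ls. length ls = n \<and> (\<forall>l\<in>set ls. continuous_on U l) \<and>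
    (\<forall>t\<in>U. sorted (map (\<lambda>l. l t) ls) \<and> P t = linear_product (map (\<lambda>l. l t) ls))"
  using assms
proof (induction n arbitrary: P)
  case 0
  then show ?case by (intro exI[of _ "[]"]) auto
next
  case (Suc n)
  define m where "m t = Min {x. poly (P t) x = 0}" for t
  have fin: "finite {x. poly (P t) x = 0}" "{x. poly (P t) x = 0} \<noteq> {}" if "t \<in> U" for t
    using Suc.prems(2)[OF that] by (auto simp: poly_linear_product_eq_0_iff length_Suc_conv)
  have m: "poly (P t) (m t) = 0" "poly (P t) x = 0 \<Longrightarrow> m t \<le> x" if "t \<in> U" for t x
    using Min_in[OF fin[OF that]] Min_le[OF fin(1)[OF that]] by (auto simp: m_def)
  have cm: "continuous_on U m"
    by (rule continuous_on_least_root[where P = P and n = "Suc n"]) (use Suc.prems m in auto)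
  define Q where "Q t = synthetic_div (P t) (m t)" for t
  have PQ: "P t = [:- m t, 1:] * Q t" if "t \<in> U" for t
    using synthetic_div_correct'[of "m t" "P t"] m(1)[OF that] by (simp add: Q_def)
  have "continuous_on U (\<lambda>t. coeff (Q t) i)" for i
    unfolding Q_def using Suc.prems(2)
    by (intro continuous_on_coeff_synthetic_div[where n = "Suc n"] Suc.prems(1) cm)
      (force simp: degree_linear_product)
  moreover have "\<exists>xs. length xs = n \<and> Q t = linear_product xs" if t: "t \<in> U" for t
  proof -
    obtain xs where xs: "length xs = Suc n" "P t = linear_product xs" using Suc.prems(2) t by blast
    then have "m t \<in> set xs" using m(1)[OF t] by (simp add: poly_linear_product_eq_0_iff)
    then have "linear_product xs = linear_product (m t # remove1 (m t) xs)" and l: "length (remove1 (m t) xs) = n"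
      using xs(1) by (auto intro!: linear_product_cong_mset simp: length_remove1 simp del: linear_product_Cons)
    then have "[:- m t, 1:] * Q t = [:- m t, 1:] * linear_product (remove1 (m t) xs)"
      using PQ[OF t] xs(2) by simp
    then have "Q t = linear_product (remove1 (m t) xs)"
      by (metis mult_cancel_left pCons_eq_0_iff zero_neq_one)
    then show ?thesis using l by blast
  qed
  ultimately obtain ls where ls: "length ls = n" "\<forall>l\<in>set ls. continuous_on U l"
    "\<forall>t\<in>U. sorted (map (\<lambda>l. l t) ls) \<and> Q t = linear_product (map (\<lambda>l. l t) ls)"
    using Suc.IH[of Q] by blast
  show ?case
  proof (intro exI[of _ "m # ls"] conjI ballI)
    fix t assume t: "t \<in> U"
    show P: "P t = linear_product (map (\<lambda>l. l t) (m # ls))"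
      using PQ[OF t] ls(3) t by simp
    then have "\<forall>x\<in>set (map (\<lambda>l. l t) ls). poly (P t) x = 0"
      unfolding P poly_linear_product_eq_0_iff by simp
    then show "sorted (map (\<lambda>l. l t) (m # ls))"
      using ls(3) t m(2)[OF t] by simp
  qed (use ls cm in auto)
qed

lemma hyperbolic_curve_sorted_roots:
  assumes "hyperbolic_curve_on U n P"
  obtains ls where "length ls = n" "\<And>l. l \<in> set ls \<Longrightarrow> continuous_on U l"
    "\<And>t. t \<in> U \<Longrightarrow> sorted (map (\<lambda>l. l t) ls)"
    "\<And>t. t \<in> U \<Longrightarrow> P t = linear_product (map (\<lambda>l. l t) ls)"
proof -
  have "\<exists>xs. length xs = n \<and> P t = linear_product xs" if "t \<in> U" for t
    using assms that unfolding hyperbolic_curve_on_def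
    by (metis hyperbolic_imp_linear_product degree_linear_product)
  then show thesis
    using that continuous_sorted_roots[of U P n] assms unfolding hyperbolic_curve_on_def by blast
qed

lemma linear_product_eq_iff_poly:
  "p = linear_product xs \<longleftrightarrow> (\<forall>z. poly p z = (\<Prod>x\<leftarrow>xs. z - x))"
  by (metis poly_linear_product poly_eq_poly_eq_iff ext)

section \<open>Flat functions\<close>

abbreviation real_roots :: "real poly \<Rightarrow> real set" where
  "real_roots p \<equiv> {x. poly p x = 0}"

lemma real_roots_linear_product: "real_roots (linear_product xs) = set xs"
  by (simp add: poly_linear_product_eq_0_iff)

text \<open>
  For functions that are continuous near \<open>t0\<close>, flatness is the same as infinite multiplicity. Since
  the bound concerns a punctured neighbourhood only and has no constant, it passes easily through
  the estimates.
\<close>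

definition flat_at :: "real \<Rightarrow> (real \<Rightarrow> real) \<Rightarrow> bool" where
  "flat_at t0 f \<longleftrightarrow> (\<forall>N. \<forall>\<^sub>F t in at t0. \<bar>f t\<bar> \<le> \<bar>t - t0\<bar> ^ N)"

text \<open>
  A constant factor is absorbed by one additional power of $|t - t_0|$.
\<close>

lemma flat_atI:
  assumes "\<And>N. \<exists>M. \<forall>\<^sub>F t in at t0. \<bar>f t\<bar> \<le> M * \<bar>t - t0\<bar> ^ N"
  shows "flat_at t0 f"
  unfolding flat_at_def
proof
  fix N
  obtain M where M: "\<forall>\<^sub>F t in at t0. \<bar>f t\<bar> \<le> M * \<bar>t - t0\<bar> ^ Suc N" using assms by blast
  have "((\<lambda>t. M * \<bar>t - t0\<bar>) \<longlongrightarrow> M * \<bar>t0 - t0\<bar>) (at t0)"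
    by (intro tendsto_intros)
  then have "\<forall>\<^sub>F t in at t0. M * \<bar>t - t0\<bar> < 1"
    by (rule order_tendstoD) simp
  then show "\<forall>\<^sub>F t in at t0. \<bar>f t\<bar> \<le> \<bar>t - t0\<bar> ^ N"
    using M
  proof eventually_elim
    case (elim t)
    have "M * \<bar>t - t0\<bar> ^ Suc N = (M * \<bar>t - t0\<bar>) * \<bar>t - t0\<bar> ^ N" by simp
    also have "\<dots> \<le> 1 * \<bar>t - t0\<bar> ^ N" using elim by (intro mult_right_mono) auto
    finally show ?case using elim by simp
  qed
qed

lemma multiplicity_infinite_imp_flat:
  assumes "multiplicity_at t0 f = \<infinity>"
  shows "flat_at t0 f"
proof (rule flat_atI)
  fix N
  let ?S = "{enat q | q. \<exists>U g. open U \<and> t0 \<in> U \<and> continuous_on U g \<and>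
                            (\<forall>t\<in>U. f t = (t - t0) ^ q * g t)}"
  have "enat N < Sup ?S" using assms unfolding multiplicity_at_def by simp
  then obtain x where "x \<in> ?S" "enat N < x" unfolding less_Sup_iff by blast
  then obtain q U g where q: "N < q" and U: "open U" "t0 \<in> U" "continuous_on U g"
      "\<forall>t\<in>U. f t = (t - t0) ^ q * g t" by auto
  have "(g \<longlongrightarrow> g t0) (at t0)"
    using U by (simp add: continuous_on_eq_continuous_at isCont_def)
  then have "((\<lambda>t. \<bar>g t\<bar>) \<longlongrightarrow> \<bar>g t0\<bar>) (at t0)" by (rule tendsto_rabs)
  then have 1: "\<forall>\<^sub>F t in at t0. \<bar>g t\<bar> < \<bar>g t0\<bar> + 1"
    by (rule order_tendstoD) simp
  have 2: "\<forall>\<^sub>F t in at t0. t \<in> U"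
    using U by (simp add: eventually_at_topological) blast
  have "\<forall>\<^sub>F t in at t0. dist t t0 < 1"
    unfolding eventually_at by (intro exI[of _ 1]) auto
  then have "\<forall>\<^sub>F t in at t0. \<bar>f t\<bar> \<le> (\<bar>g t0\<bar> + 1) * \<bar>t - t0\<bar> ^ N"
    using 1 2
  proof eventually_elim
    case (elim t)
    have "\<bar>f t\<bar> = \<bar>g t\<bar> * \<bar>t - t0\<bar> ^ q"
      using U(4) elim by (simp add: abs_mult power_abs)
    also have "\<dots> \<le> (\<bar>g t0\<bar> + 1) * \<bar>t - t0\<bar> ^ N"
      using elim q by (intro mult_mono power_decreasing) (auto simp: dist_real_def)
    finally show ?case .
  qed
  then show "\<exists>M. \<forall>\<^sub>F t in at t0. \<bar>f t\<bar> \<le> M * \<bar>t - t0\<bar> ^ N" ..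
qed

text \<open>
  The quotient $f(t)/(t - t_0)^q$ tends to $0$, as $f$ is bounded by the power $q + 1$. The value
  of the quotient at \<open>t0\<close> is $0$ as well: for $q > 0$ as a division by zero, and for $q = 0$ because
  flatness and continuity force $f(t_0) = 0$.
\<close>

lemma flat_imp_multiplicity_infinite:
  assumes flat: "flat_at t0 f" and U: "open U" "t0 \<in> U" and f: "continuous_on U f"
  shows "multiplicity_at t0 f = \<infinity>"
proof -
  let ?S = "{enat q | q. \<exists>U g. open U \<and> t0 \<in> U \<and> continuous_on U g \<and>
                            (\<forall>t\<in>U. f t = (t - t0) ^ q * g t)}"
  have ft: "(f \<longlongrightarrow> f t0) (at t0)"
    using f U by (simp add: continuous_on_eq_continuous_at isCont_def)
  have lin: "((\<lambda>t. \<bar>t - t0\<bar>) \<longlongrightarrow> 0) (at t0)"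
    by (auto intro!: tendsto_eq_intros)
  have "(f \<longlongrightarrow> 0) (at t0)"
    by (rule Lim_null_comparison[OF _ lin])
      (use flat in \<open>auto simp: flat_at_def dest: spec[of _ 1]\<close>)
  then have f0: "f t0 = 0" using ft LIM_unique by blast
  have "enat q \<in> ?S" for q
  proof -
    define g where "g t = f t / (t - t0) ^ q" for t
    have eq: "f t = (t - t0) ^ q * g t" for t
      by (cases "t = t0") (simp_all add: g_def f0)
    have g0: "g t0 = 0" by (cases q) (simp_all add: g_def f0)
    have "\<forall>\<^sub>F t in at t0. norm (g t) \<le> \<bar>t - t0\<bar>"
      using flat[unfolded flat_at_def, rule_format, of "Suc q"] eventually_neq_at_within[of t0]
    proof eventually_elim
      case (elim t)
      then have "\<bar>t - t0\<bar> ^ q * \<bar>g t\<bar> \<le> \<bar>t - t0\<bar> ^ q * \<bar>t - t0\<bar>"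
        unfolding eq[of t] abs_mult power_abs by simp
      moreover have "\<bar>t - t0\<bar> ^ q > 0" using elim by simp
      ultimately show ?case by simp
    qed
    then have "(g \<longlongrightarrow> 0) (at t0)" by (rule Lim_null_comparison[OF _ lin])
    then have "isCont g t0" by (simp add: isCont_def g0)
    moreover have "isCont g t" if "t \<in> U" "t \<noteq> t0" for t
    proof -
      have "isCont f t" using f U that by (simp add: continuous_on_eq_continuous_at)
      then show ?thesis unfolding g_def using that by (intro continuous_intros) auto
    qed
    ultimately have "continuous_on U g"
      by (metis continuous_at_imp_continuous_on)
    then show ?thesis using U eq by blast
  qed
  then have "enat q \<le> Sup ?S" for q by (rule Sup_upper)
  then have "enat q \<le> multiplicity_at t0 f" for q unfolding multiplicity_at_def .
  then show ?thesis
    by (metis enat_ord_simps(1) not_infinity_eq Suc_n_not_le_n)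
qed

section \<open>Clusters of roots and the three elementary steps\<close>

definition C_roots_on :: "nat \<Rightarrow> real set \<Rightarrow> (real \<Rightarrow> real poly) \<Rightarrow> bool" where
  "C_roots_on p U P \<longleftrightarrow> (\<exists>ls. (\<forall>l\<in>set ls. C_on (enat p) l U) \<and>
     (\<forall>t\<in>U. P t = linear_product (map (\<lambda>l. l t) ls)))"

definition C_roots_near :: "nat \<Rightarrow> real \<Rightarrow> (real \<Rightarrow> real poly) \<Rightarrow> bool" where
  "C_roots_near p t0 P \<longleftrightarrow> (\<exists>U. open U \<and> t0 \<in> U \<and> C_roots_on p U P)"

text \<open>
  The roots form at most \<open>L\<close> clusters of infinitely small diameter. The condition is phrased through
  sets of roots, not through the clusters themselves, since then it is
  preserved by products of coprime factors and by affine changes of the roots without any bookkeeping.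
\<close>

definition clustered_roots :: "nat \<Rightarrow> real \<Rightarrow> (real \<Rightarrow> real poly) \<Rightarrow> bool" where
  "clustered_roots L t0 P \<longleftrightarrow> (\<forall>N. \<forall>\<^sub>F t in at t0. \<forall>S \<subseteq> real_roots (P t). L < card S \<longrightarrow>
     (\<exists>x\<in>S. \<exists>y\<in>S. x \<noteq> y \<and> \<bar>x - y\<bar> \<le> \<bar>t - t0\<bar> ^ N))"

text \<open>
  The invariant of the induction. Whether additional roots occur can only be decided for the
  whole curve, by \<open>no_extra_roots\<close>, so the induction leaves this alternative open. The lower
  bound for the number of roots makes an excess in one factor visible in the product.
\<close>

definition root_dichotomy :: "nat \<Rightarrow> nat \<Rightarrow> real \<Rightarrow> (real \<Rightarrow> real poly) \<Rightarrow> bool" where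
  "root_dichotomy p L t0 P \<longleftrightarrow> clustered_roots L t0 P \<and>
     (\<forall>\<^sub>F t in at t0. L \<le> card (real_roots (P t))) \<and>
     ((\<exists>\<^sub>F t in at t0. L < card (real_roots (P t))) \<or> C_roots_near p t0 P)"

lemma hyperbolic_curve_on_subset: "hyperbolic_curve_on U n P \<Longrightarrow> V \<subseteq> U \<Longrightarrow> hyperbolic_curve_on V n P"
  unfolding hyperbolic_curve_on_def by (meson continuous_on_subset subsetD)

lemma hyperbolic_curve_near_roots:
  assumes "hyperbolic_curve_near t0 n P"
  obtains U ls where "open U" "t0 \<in> U" "hyperbolic_curve_on U n P" "length ls = n"
    "\<And>l. l \<in> set ls \<Longrightarrow> continuous_on U l"
    "\<And>t. t \<in> U \<Longrightarrow> P t = linear_product (map (\<lambda>l. l t) ls)"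
  using assms hyperbolic_curve_sorted_roots unfolding hyperbolic_curve_near_def by metis

lemma eventually_nhds_open: "open U \<Longrightarrow> t0 \<in> U \<Longrightarrow> \<forall>\<^sub>F t in nhds t0. t \<in> U"
  by (auto simp: eventually_nhds)

lemma eventually_at_nhdsI: "\<forall>\<^sub>F t in nhds t0. Q t \<Longrightarrow> \<forall>\<^sub>F t in at t0. Q t"
  by (simp add: eventually_at_filter eventually_mono)

lemma C_coeffs_near_mono: "C_coeffs_near k t0 P \<Longrightarrow> k' \<le> k \<Longrightarrow> C_coeffs_near k' t0 P"
  unfolding C_coeffs_near_def using C_on_mono by blast

text \<open>
  The continuous roots of the two factors differ at \<open>t0\<close>, hence also near \<open>t0\<close>.
\<close>

lemma disjoint_roots_near:
  assumes "hyperbolic_curve_near t0 n1 P1" "hyperbolic_curve_near t0 n2 P2"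
    and "\<not> (\<exists>x. poly (P1 t0) x = 0 \<and> poly (P2 t0) x = 0)"
  shows "\<forall>\<^sub>F t in nhds t0. real_roots (P1 t) \<inter> real_roots (P2 t) = {} \<and> P1 t \<noteq> 0 \<and> P2 t \<noteq> 0"
proof -
  obtain U ls where U: "open U" "t0 \<in> U" "\<And>l. l \<in> set ls \<Longrightarrow> continuous_on U l"
    "\<And>t. t \<in> U \<Longrightarrow> P1 t = linear_product (map (\<lambda>l. l t) ls)"
    using hyperbolic_curve_near_roots[OF assms(1)] by metis
  obtain V ms where V: "open V" "t0 \<in> V" "\<And>l. l \<in> set ms \<Longrightarrow> continuous_on V l"
    "\<And>t. t \<in> V \<Longrightarrow> P2 t = linear_product (map (\<lambda>l. l t) ms)"
    using hyperbolic_curve_near_roots[OF assms(2)] by metis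
  have "\<forall>\<^sub>F t in nhds t0. l t \<noteq> m t" if "l \<in> set ls" "m \<in> set ms" for l m
  proof -
    have ne: "l t0 - m t0 \<noteq> 0"
      using assms(3) U(2,4) V(2,4) that by (auto simp: poly_linear_product_eq_0_iff)
    have "isCont l t0" "isCont m t0"
      using U(1,2) U(3)[OF that(1)] V(1,2) V(3)[OF that(2)] by (simp_all add: continuous_on_eq_continuous_at)
    then have "((\<lambda>t. l t - m t) \<longlongrightarrow> l t0 - m t0) (nhds t0)"
      by (intro tendsto_intros) (simp_all add: isCont_def tendsto_at_iff_tendsto_nhds)
    then have "\<forall>\<^sub>F t in nhds t0. l t - m t \<noteq> 0"
      using ne by (rule tendsto_imp_eventually_ne)
    then show ?thesis by simp
  qed
  then have "\<forall>\<^sub>F t in nhds t0. \<forall>l\<in>set ls. \<forall>m\<in>set ms. l t \<noteq> m t"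
    by (simp add: eventually_ball_finite)
  then show ?thesis
    using eventually_nhds_open[OF U(1,2)] eventually_nhds_open[OF V(1,2)]
    by eventually_elim
      (auto simp: U V real_roots_linear_product linear_product_nonzero)
qed

text \<open>
  Near \<open>t0\<close> the roots of \<open>P\<close> are the disjoint union of those of the factors, so numbers of roots
  add up. A set of more than \<open>L1 + L2\<close> roots has more than \<open>L1\<close> roots of \<open>P1\<close> or more than \<open>L2\<close>
  roots of \<open>P2\<close>.
\<close>

lemma root_dichotomy_product:
  assumes c1: "hyperbolic_curve_near t0 n1 P1" and c2: "hyperbolic_curve_near t0 n2 P2"
    and eq: "\<forall>\<^sub>F t in nhds t0. P t = P1 t * P2 t"
    and disj: "\<not> (\<exists>x. poly (P1 t0) x = 0 \<and> poly (P2 t0) x = 0)"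
    and d1: "root_dichotomy p L1 t0 P1" and d2: "root_dichotomy p L2 t0 P2"
  shows "root_dichotomy p (L1 + L2) t0 P"
proof -
  have "\<forall>\<^sub>F t in nhds t0. real_roots (P t) = real_roots (P1 t) \<union> real_roots (P2 t)
      \<and> finite (real_roots (P1 t)) \<and> finite (real_roots (P2 t))
      \<and> real_roots (P1 t) \<inter> real_roots (P2 t) = {}"
    using eq disjoint_roots_near[OF c1 c2 disj]
    by eventually_elim (auto simp: poly_roots_finite)
  then have near: "\<forall>\<^sub>F t in at t0. real_roots (P t) = real_roots (P1 t) \<union> real_roots (P2 t)
      \<and> finite (real_roots (P1 t)) \<and> finite (real_roots (P2 t))
      \<and> real_roots (P1 t) \<inter> real_roots (P2 t) = {}"
    by (rule eventually_at_nhdsI)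
  have card: "\<forall>\<^sub>F t in at t0. card (real_roots (P t)) = card (real_roots (P1 t)) + card (real_roots (P2 t))"
    using near by eventually_elim (metis card_Un_disjoint)
  have low1: "\<forall>\<^sub>F t in at t0. L1 \<le> card (real_roots (P1 t))"
    and low2: "\<forall>\<^sub>F t in at t0. L2 \<le> card (real_roots (P2 t))"
    using d1 d2 by (simp_all add: root_dichotomy_def)
  have "clustered_roots (L1 + L2) t0 P"
    unfolding clustered_roots_def
  proof
    fix N
    have "\<forall>\<^sub>F t in at t0. \<forall>S \<subseteq> real_roots (P1 t). L1 < card S \<longrightarrow>
        (\<exists>x\<in>S. \<exists>y\<in>S. x \<noteq> y \<and> \<bar>x - y\<bar> \<le> \<bar>t - t0\<bar> ^ N)"
      "\<forall>\<^sub>F t in at t0. \<forall>S \<subseteq> real_roots (P2 t). L2 < card S \<longrightarrow>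
        (\<exists>x\<in>S. \<exists>y\<in>S. x \<noteq> y \<and> \<bar>x - y\<bar> \<le> \<bar>t - t0\<bar> ^ N)"
      using d1 d2 by (simp_all add: root_dichotomy_def clustered_roots_def)
    then show "\<forall>\<^sub>F t in at t0. \<forall>S \<subseteq> real_roots (P t). L1 + L2 < card S \<longrightarrow>
        (\<exists>x\<in>S. \<exists>y\<in>S. x \<noteq> y \<and> \<bar>x - y\<bar> \<le> \<bar>t - t0\<bar> ^ N)"
      using near
    proof eventually_elim
      case (elim t)
      show ?case
      proof (intro allI impI)
        fix S assume S: "S \<subseteq> real_roots (P t)" "L1 + L2 < card S"
        let ?S1 = "S \<inter> real_roots (P1 t)" and ?S2 = "S \<inter> real_roots (P2 t)"
        have "S = ?S1 \<union> ?S2" using S(1) elim(3) by blast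
        then have "card S \<le> card ?S1 + card ?S2" by (metis card_Un_le)
        then consider "L1 < card ?S1" | "L2 < card ?S2" using S(2) by linarith
        then show "\<exists>x\<in>S. \<exists>y\<in>S. x \<noteq> y \<and> \<bar>x - y\<bar> \<le> \<bar>t - t0\<bar> ^ N"
        proof cases
          case 1
          then obtain x y where "x \<in> ?S1" "y \<in> ?S1" "x \<noteq> y" "\<bar>x - y\<bar> \<le> \<bar>t - t0\<bar> ^ N"
            using elim(1)[rule_format, of ?S1] by auto
          then show ?thesis by blast
        next
          case 2
          then obtain x y where "x \<in> ?S2" "y \<in> ?S2" "x \<noteq> y" "\<bar>x - y\<bar> \<le> \<bar>t - t0\<bar> ^ N"
            using elim(2)[rule_format, of ?S2] by auto
          then show ?thesis by blast
        qed
      qed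
    qed
  qed
  moreover have "\<forall>\<^sub>F t in at t0. L1 + L2 \<le> card (real_roots (P t))"
    using card low1 low2 by eventually_elim simp
  moreover have "(\<exists>\<^sub>F t in at t0. L1 + L2 < card (real_roots (P t))) \<or> C_roots_near p t0 P"
  proof (cases "(\<exists>\<^sub>F t in at t0. L1 < card (real_roots (P1 t))) \<or> (\<exists>\<^sub>F t in at t0. L2 < card (real_roots (P2 t)))")
    case True
    then show ?thesis
    proof
      assume many: "\<exists>\<^sub>F t in at t0. L1 < card (real_roots (P1 t))"
      have "\<forall>\<^sub>F t in at t0. L1 < card (real_roots (P1 t)) \<longrightarrow> L1 + L2 < card (real_roots (P t))"
        using card low2 by eventually_elim simp
      then show ?thesis using frequently_mp[OF _ many] by simp
    next
      assume many: "\<exists>\<^sub>F t in at t0. L2 < card (real_roots (P2 t))"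
      have "\<forall>\<^sub>F t in at t0. L2 < card (real_roots (P2 t)) \<longrightarrow> L1 + L2 < card (real_roots (P t))"
        using card low1 by eventually_elim simp
      then show ?thesis using frequently_mp[OF _ many] by simp
    qed
  next
    case False
    then have "C_roots_near p t0 P1" "C_roots_near p t0 P2"
      using d1 d2 by (simp_all add: root_dichotomy_def)
    then obtain U ls V ms where U: "open U" "t0 \<in> U" "\<forall>l\<in>set ls. C_on (enat p) l U"
        "\<forall>t\<in>U. P1 t = linear_product (map (\<lambda>l. l t) ls)"
      and V: "open V" "t0 \<in> V" "\<forall>l\<in>set ms. C_on (enat p) l V"
        "\<forall>t\<in>V. P2 t = linear_product (map (\<lambda>l. l t) ms)"
      unfolding C_roots_near_def C_roots_on_def by blast
    obtain W where W: "open W" "t0 \<in> W" "\<forall>t\<in>W. P t = P1 t * P2 t"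
      using eq by (auto simp: eventually_nhds)
    show ?thesis
      unfolding C_roots_near_def C_roots_on_def
    proof (intro disjI2 exI[of _ "U \<inter> V \<inter> W"] conjI exI[of _ "ls @ ms"])
      show "\<forall>l\<in>set (ls @ ms). C_on (enat p) l (U \<inter> V \<inter> W)"
        using U V by (auto intro: C_on_subset)
    qed (use U V W in \<open>auto simp: linear_product_append\<close>)
  qed
  ultimately show ?thesis by (simp add: root_dichotomy_def)
qed

lemma signed_coeff_1_linear_product:
  assumes "length xs > 0"
  shows "signed_coeff (linear_product xs) 1 = sum_list xs"
  using assms top_coeffs_linear_product(2)[of xs "length xs - 1"]
  by (simp add: signed_coeff_def degree_linear_product)

lemma signed_coeff_2_linear_product:
  assumes "length xs > 1"
  shows "2 * signed_coeff (linear_product xs) 2 = (sum_list xs)\<^sup>2 - (\<Sum>x\<leftarrow>xs. x\<^sup>2)"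
  using assms top_coeffs_linear_product(3)[of xs "length xs - 2"]
  by (simp add: signed_coeff_def degree_linear_product)

lemma centre_linear_product:
  assumes "length xs > 0"
  shows "centre (linear_product xs) = linear_product (map (\<lambda>x. x - sum_list xs / length xs) xs)"
  unfolding centre_def signed_coeff_1_linear_product[OF assms] degree_linear_product
  by (rule pcompose_linear_product)

text \<open>
  Centring makes $a_1$ vanish.
\<close>

lemma sum_list_centred:
  fixes xs :: "real list"
  assumes "length xs > 0"
  shows "(\<Sum>x\<leftarrow>xs. x - sum_list xs / length xs) = 0"
  using assms by (simp add: sum_list_subtractf sum_list_triv)

lemma C_on_signed_coeff:
  assumes "open U" "hyperbolic_curve_on U n P" "\<And>i. C_on (enat k) (\<lambda>t. coeff (P t) i) U"
  shows "C_on (enat k) (\<lambda>t. signed_coeff (P t) j) U"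
proof (rule C_on_cong[OF assms(1)])
  show "C_on (enat k) (\<lambda>t. (-1) ^ j * coeff (P t) (n - j)) U"
    by (intro C_on_mult C_on_const assms)
qed (use assms(2) in \<open>auto simp: signed_coeff_def hyperbolic_curve_on_def\<close>)

lemma root_dichotomy_linear:
  assumes c: "hyperbolic_curve_near t0 1 P" and C: "C_coeffs_near (enat p) t0 P"
  shows "root_dichotomy p 1 t0 P"
proof -
  obtain U ls where U: "open U" "t0 \<in> U" "hyperbolic_curve_on U 1 P" "length ls = 1"
    "\<And>t. t \<in> U \<Longrightarrow> P t = linear_product (map (\<lambda>l. l t) ls)"
    using hyperbolic_curve_near_roots[OF c] by metis
  obtain l where l: "ls = [l]" using U(4) by (auto simp: length_Suc_conv)
  obtain V where V: "open V" "t0 \<in> V" "\<And>i. C_on (enat p) (\<lambda>t. coeff (P t) i) V"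
    using C unfolding C_coeffs_near_def by blast
  have P: "P t = linear_product [l t]" if "t \<in> U" for t using U(5)[OF that] by (simp add: l)
  have s: "signed_coeff (P t) 1 = l t" if "t \<in> U" for t
    unfolding P[OF that] by (subst signed_coeff_1_linear_product) simp_all
  have inU: "\<forall>\<^sub>F t in at t0. t \<in> U"
    by (intro eventually_at_nhdsI eventually_nhds_open U)
  have P1: "P t = linear_product (map (\<lambda>l. l t) [\<lambda>t. signed_coeff (P t) 1])" if "t \<in> U" for t
    unfolding list.map s[OF that] by (rule P[OF that])
  have "C_on (enat p) (\<lambda>t. signed_coeff (P t) 1) (U \<inter> V)"
    using U V by (intro C_on_signed_coeff[where n = 1])
      (auto intro: C_on_subset hyperbolic_curve_on_subset)
  then have roots: "C_roots_near p t0 P"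
    unfolding C_roots_near_def C_roots_on_def using U(1,2) V(1,2) P1
    by (intro exI[of _ "U \<inter> V"] conjI exI[of _ "[\<lambda>t. signed_coeff (P t) 1]"]) auto
  have "real_roots (P t) = {l t}" if "t \<in> U" for t
    unfolding P[OF that] real_roots_linear_product by simp
  then have R: "\<forall>\<^sub>F t in at t0. real_roots (P t) = {l t}"
    using inU by (rule eventually_mono[rotated])
  have few: "\<forall>\<^sub>F t in at t0. \<forall>S \<subseteq> real_roots (P t). \<not> 1 < card S"
    using R by eventually_elim (auto dest!: subset_singletonD)
  have "clustered_roots 1 t0 P"
    unfolding clustered_roots_def by (intro allI eventually_mono[OF few]) blast
  moreover have "\<forall>\<^sub>F t in at t0. 1 \<le> card (real_roots (P t))"
    using R by eventually_elim simp
  ultimately show ?thesis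
    using roots unfolding root_dichotomy_def by blast
qed

text \<open>
  For centred roots $-2 a_2$ is the sum of squares, so all roots lie infinitely close to
  $a_1/n$ and there is a single cluster. If \<open>P\<close> has only one root near \<open>t0\<close>, this root is
  $a_1/n$, which is as smooth as the coefficients.
\<close>

lemma root_dichotomy_flat:
  assumes c: "hyperbolic_curve_near t0 n P" and n: "n > 1"
    and single: "\<forall>x y. poly (P t0) x = 0 \<longrightarrow> poly (P t0) y = 0 \<longrightarrow> x = y"
    and flat: "flat_at t0 (\<lambda>t. signed_coeff (centre (P t)) 2)"
    and C: "C_coeffs_near (enat p) t0 P"
  shows "root_dichotomy p 1 t0 P"
proof -
  obtain U ls where U: "open U" "t0 \<in> U" "hyperbolic_curve_on U n P" "length ls = n"
    "\<And>t. t \<in> U \<Longrightarrow> P t = linear_product (map (\<lambda>l. l t) ls)"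
    using hyperbolic_curve_near_roots[OF c] by metis
  obtain V where V: "open V" "t0 \<in> V" "\<And>i. C_on (enat p) (\<lambda>t. coeff (P t) i) V"
    using C unfolding C_coeffs_near_def by blast
  have inU: "\<forall>\<^sub>F t in at t0. t \<in> U"
    by (intro eventually_at_nhdsI eventually_nhds_open U)
  have dist: "(x - y)\<^sup>2 \<le> 8 * \<bar>signed_coeff (centre (P t)) 2\<bar>"
    if t: "t \<in> U" "poly (P t) x = 0" "poly (P t) y = 0" for t x y
  proof -
    define xs where "xs = map (\<lambda>l. l t) ls"
    define c where "c = sum_list xs / length xs"
    define zs where "zs = map (\<lambda>x. x - c) xs"
    have len: "length xs = n" "length zs = n" by (simp_all add: xs_def zs_def U)
    have P: "P t = linear_product xs" using U(5) t by (simp add: xs_def)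
    have ctr: "centre (P t) = linear_product zs"
      unfolding P zs_def c_def using n len by (intro centre_linear_product) simp
    have "sum_list zs = 0"
      unfolding zs_def c_def using n len by (intro sum_list_centred) simp
    then have sq: "(\<Sum>z\<leftarrow>zs. z\<^sup>2) = - 2 * signed_coeff (centre (P t)) 2"
      using signed_coeff_2_linear_product[of zs] n len unfolding ctr by simp
    have mem: "z\<^sup>2 \<le> 2 * \<bar>signed_coeff (centre (P t)) 2\<bar>" if "z \<in> set zs" for z
    proof -
      have "z\<^sup>2 \<le> (\<Sum>z\<leftarrow>zs. z\<^sup>2)"
        using that by (intro member_le_sum_list) auto
      then show ?thesis using sq by linarith
    qed
    have "x - c \<in> set zs" "y - c \<in> set zs"
      using t(2,3) by (simp_all add: P poly_linear_product_eq_0_iff zs_def)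
    then have bound: "(x - c)\<^sup>2 \<le> 2 * \<bar>signed_coeff (centre (P t)) 2\<bar>" "(y - c)\<^sup>2 \<le> 2 * \<bar>signed_coeff (centre (P t)) 2\<bar>"
      using mem by blast+
    have "(x - y)\<^sup>2 \<le> (x - y)\<^sup>2 + ((x - c) + (y - c))\<^sup>2"
      by simp
    also have "\<dots> = 2 * ((x - c)\<^sup>2 + (y - c)\<^sup>2)"
      by (simp add: power2_eq_square algebra_simps)
    also have "\<dots> \<le> 2 * (2 * \<bar>signed_coeff (centre (P t)) 2\<bar> + 2 * \<bar>signed_coeff (centre (P t)) 2\<bar>)"
      using bound by (intro mult_left_mono add_mono) simp_all
    finally show ?thesis by simp
  qed
  have "clustered_roots 1 t0 P"
    unfolding clustered_roots_def
  proof
    fix N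
    \<comment> \<open>The estimate \<open>dist\<close> with $a_2$ of order $2N + 2$ yields order $N$: two powers of
      $|t - t_0|$ absorb the factor $8$, and the square root halves the rest.\<close>
    have "((\<lambda>t. 8 * (t - t0)\<^sup>2) \<longlongrightarrow> 8 * (t0 - t0)\<^sup>2) (at t0)"
      by (intro tendsto_intros)
    then have "\<forall>\<^sub>F t in at t0. 8 * (t - t0)\<^sup>2 < 1"
      by (rule order_tendstoD) simp
    then show "\<forall>\<^sub>F t in at t0. \<forall>S \<subseteq> real_roots (P t). 1 < card S \<longrightarrow>
        (\<exists>x\<in>S. \<exists>y\<in>S. x \<noteq> y \<and> \<bar>x - y\<bar> \<le> \<bar>t - t0\<bar> ^ N)"
      using flat[unfolded flat_at_def, rule_format, of "2 * N + 2"] inU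
    proof eventually_elim
      case (elim t)
      show ?case
      proof (intro allI impI)
        fix S assume S: "S \<subseteq> real_roots (P t)" "1 < card S"
        then obtain x y where xy: "x \<in> S" "y \<in> S" "x \<noteq> y"
          by (metis card_le_Suc0_iff_eq card.infinite One_nat_def not_less not_less0)
        then have "(x - y)\<^sup>2 \<le> 8 * \<bar>signed_coeff (centre (P t)) 2\<bar>"
          using S elim by (intro dist) auto
        also have "\<dots> \<le> 8 * \<bar>t - t0\<bar> ^ (2 * N + 2)" using elim by simp
        also have "\<bar>t - t0\<bar> ^ (2 * N + 2) = (\<bar>t - t0\<bar> ^ N)\<^sup>2 * (t - t0)\<^sup>2"
          by (simp only: power_add power_even_eq power2_abs)
        also have "8 * ((\<bar>t - t0\<bar> ^ N)\<^sup>2 * (t - t0)\<^sup>2) = (8 * (t - t0)\<^sup>2) * (\<bar>t - t0\<bar> ^ N)\<^sup>2"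
          by (simp only: mult_ac)
        also have "\<dots> \<le> 1 * (\<bar>t - t0\<bar> ^ N)\<^sup>2" using elim by (intro mult_right_mono) auto
        finally have "\<bar>x - y\<bar> \<le> \<bar>t - t0\<bar> ^ N"
          by (intro abs_le_square_iff[THEN iffD2, of _ "\<bar>t - t0\<bar> ^ N", simplified]) simp
        then show "\<exists>x\<in>S. \<exists>y\<in>S. x \<noteq> y \<and> \<bar>x - y\<bar> \<le> \<bar>t - t0\<bar> ^ N" using xy by blast
      qed
    qed
  qed
  moreover have "real_roots (P t) = (\<lambda>l. l t) ` set ls" if "t \<in> U" for t
    unfolding U(5)[OF that] real_roots_linear_product by simp
  then have "1 \<le> card (real_roots (P t))" if "t \<in> U" for t
    using that U(4) n by (simp add: Suc_le_eq card_gt_0_iff) auto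
  then have "\<forall>\<^sub>F t in at t0. 1 \<le> card (real_roots (P t))"
    using inU by (rule eventually_mono[rotated])
  moreover have "C_roots_near p t0 P" if nf: "\<not> (\<exists>\<^sub>F t in at t0. 1 < card (real_roots (P t)))"
  proof -
    have "\<forall>\<^sub>F t in at t0. \<not> 1 < card (real_roots (P t))"
      using nf by (simp add: not_frequently)
    then obtain W where W: "open W" "t0 \<in> W" "\<And>t. t \<in> W \<Longrightarrow> t \<noteq> t0 \<Longrightarrow> \<not> 1 < card (real_roots (P t))"
      unfolding eventually_at_topological by auto
    have eq: "P t = linear_product (replicate n (signed_coeff (P t) 1 / n))" if t: "t \<in> U" "t \<in> W" for t
    proof -
      define xs where "xs = map (\<lambda>l. l t) ls"
      have P: "P t = linear_product xs" using U(5) t by (simp add: xs_def)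
      have len: "length xs = n" by (simp add: xs_def U)
      have "x = y" if "x \<in> set xs" "y \<in> set xs" for x y
      proof (cases "t = t0")
        case True
        then show ?thesis using single that P by (auto simp: poly_linear_product_eq_0_iff)
      next
        case False
        then have "card (set xs) \<le> Suc 0"
          using W(3)[OF t(2)] unfolding P real_roots_linear_product by simp
        then show ?thesis using that by (simp add: card_le_Suc0_iff_eq)
      qed
      then have "\<forall>x\<in>set xs. x = hd xs"
        using n len by (metis hd_in_set length_greater_0_conv not_less_zero neq0_conv)
      then have xs: "xs = replicate n (hd xs)"
        using len by (metis replicate_eqI)
      then have "sum_list xs = n * hd xs"
        by (metis sum_list_replicate)
      then have "signed_coeff (P t) 1 = n * hd xs"
        unfolding P using n len by (subst signed_coeff_1_linear_product) auto
      then show ?thesis using xs n P by simp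
    qed
    have "C_on (enat p) (\<lambda>t. (1 / n) * signed_coeff (P t) 1) (U \<inter> V \<inter> W)"
      using U V W by (intro C_on_mult C_on_const C_on_signed_coeff[where n = n])
        (auto intro: C_on_subset hyperbolic_curve_on_subset)
    then show ?thesis
      unfolding C_roots_near_def C_roots_on_def using U(1,2) V(1,2) W(1,2) eq
      by (intro exI[of _ "U \<inter> V \<inter> W"] conjI exI[of _ "replicate n (\<lambda>t. (1 / n) * signed_coeff (P t) 1)"])
        auto
  qed
  ultimately show ?thesis unfolding root_dichotomy_def by blast
qed

section \<open>The rescaling step\<close>

text \<open>
  The polynomial $P_{(r)}$ of the recursion at a fixed time.
\<close>

definition rescaled :: "nat \<Rightarrow> (nat \<Rightarrow> real) \<Rightarrow> real poly" where
  "rescaled n b = monom 1 n + (\<Sum>k=2..n. monom ((-1) ^ k * b k) (n - k))"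

lemma poly_rescaled: "poly (rescaled n b) y = y ^ n + (\<Sum>k=2..n. (-1) ^ k * b k * y ^ (n - k))"
  by (simp add: rescaled_def poly_sum poly_monom)

lemma coeff_rescaled:
  "coeff (rescaled n b) i =
    (if i = n then 1 else 0) + (\<Sum>k=2..n. if n - k = i then (-1) ^ k * b k else 0)"
  by (simp add: rescaled_def coeff_sum)

lemma degree_rescaled: "degree (rescaled n b) = n"
proof -
  have "degree (rescaled n b) \<le> n"
    unfolding rescaled_def
    by (intro degree_add_le degree_sum_le order_trans[OF degree_monom_le]) auto
  moreover have "coeff (rescaled n b) n = 1"
    by (simp add: coeff_rescaled) (intro sum.neutral, auto)
  ultimately show ?thesis
    by (metis le_antisym le_degree one_neq_zero)
qed

lemma centred_poly_eq:
  assumes "length zs = n" "n > 1" "sum_list zs = 0"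
  shows "poly (linear_product zs) x =
    x ^ n + (\<Sum>k=2..n. (-1) ^ k * signed_coeff (linear_product zs) k * x ^ (n - k))"
proof -
  let ?p = "linear_product zs"
  have "poly ?p x = (\<Sum>i\<le>n. coeff ?p i * x ^ i)"
    by (simp add: poly_altdef degree_linear_product assms(1))
  also have "\<dots> = (\<Sum>k\<le>n. coeff ?p (n - k) * x ^ (n - k))"
    using sum.nat_diff_reindex[of "\<lambda>i. coeff ?p i * x ^ i" "Suc n"]
    by (simp only: lessThan_Suc_atMost diff_Suc_Suc)
  also have "\<dots> = (\<Sum>k\<le>n. (-1) ^ k * signed_coeff ?p k * x ^ (n - k))"
    by (simp add: signed_coeff_def degree_linear_product assms(1) mult.assoc)
  also have "{..n} = insert 0 (insert 1 {2..n})" using assms(2) by auto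
  also have "(\<Sum>k\<in>\<dots>. (-1) ^ k * signed_coeff ?p k * x ^ (n - k)) =
      x ^ n + (\<Sum>k=2..n. (-1) ^ k * signed_coeff ?p k * x ^ (n - k))"
    using signed_coeff_1_linear_product[of zs] top_coeffs_linear_product(1)[of zs] assms
    by (simp add: signed_coeff_def degree_linear_product)
  finally show ?thesis .
qed

text \<open>
  Multiplying the roots by \<open>s\<close> multiplies the coefficient of index \<open>k\<close> by $s^k$. The case $s = 0$
  is included because the roots at \<open>t0\<close> itself have to come out right.
\<close>

lemma homogeneous_scaling:
  assumes len: "length ys = n" and "n > 1"
    and eq: "rescaled n b = linear_product ys"
  shows "x ^ n + (\<Sum>k=2..n. (-1) ^ k * (s ^ k * b k) * x ^ (n - k)) = (\<Prod>y\<leftarrow>ys. x - s * y)"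
proof (cases "s = 0")
  case True
  have "(\<Prod>y\<leftarrow>ys. x - s * y) = x ^ n"
    using len True by (simp add: prod_list_replicate map_replicate_const)
  moreover have "(\<Sum>k=2..n. (-1) ^ k * (s ^ k * b k) * x ^ (n - k)) = 0"
    using True by (intro sum.neutral) auto
  ultimately show ?thesis by simp
next
  case False
  have "(\<Prod>y\<leftarrow>ys. x - s * y) = (\<Prod>y\<leftarrow>ys. s * (x / s - y))"
    using False by (simp add: algebra_simps)
  also have "\<dots> = s ^ n * (\<Prod>y\<leftarrow>ys. x / s - y)"
    unfolding len[symmetric] by (induction ys) (simp_all add: algebra_simps)
  also have "(\<Prod>y\<leftarrow>ys. x / s - y) = poly (rescaled n b) (x / s)"
    unfolding eq by (simp add: poly_linear_product)
  also have "s ^ n * \<dots> = x ^ n + (\<Sum>k=2..n. s ^ n * ((-1) ^ k * b k * (x / s) ^ (n - k)))"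
    using False by (simp add: poly_rescaled distrib_left sum_distrib_left power_divide)
  also have "(\<Sum>k=2..n. s ^ n * ((-1) ^ k * b k * (x / s) ^ (n - k))) =
      (\<Sum>k=2..n. (-1) ^ k * (s ^ k * b k) * x ^ (n - k))"
  proof (rule sum.cong[OF refl])
    fix k assume "k \<in> {2..n}"
    then have "s ^ n = s ^ k * s ^ (n - k)" by (simp flip: power_add)
    then show "s ^ n * ((-1) ^ k * b k * (x / s) ^ (n - k)) = (-1) ^ k * (s ^ k * b k) * x ^ (n - k)"
      using False by (simp add: power_divide)
  qed
  finally show ?thesis by simp
qed

text \<open>
  This is applied with $s = (t - t_0)^r$. Since \<open>s\<close> may be \<open>0\<close>, the roots at \<open>t0\<close> itself are
  covered.
\<close>

lemma roots_of_rescaled: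
  assumes len: "length xs = n" and n: "n > 1" and p: "p = linear_product xs"
    and b: "\<And>k. k \<in> {2..n} \<Longrightarrow> signed_coeff (centre p) k = s ^ k * b k"
    and q: "rescaled n b = linear_product ys"
  shows "p = linear_product (map (\<lambda>y. signed_coeff p 1 / n + s * y) ys)"
proof -
  define c where "c = signed_coeff p 1 / n"
  have c: "c = sum_list xs / length xs"
    unfolding c_def p len using n len by (subst signed_coeff_1_linear_product) auto
  have ctr: "centre p = linear_product (map (\<lambda>x. x - c) xs)"
    unfolding p c using n len by (intro centre_linear_product) simp
  have leny: "length ys = n" by (metis q degree_rescaled degree_linear_product)
  have "poly p x = (\<Prod>z\<leftarrow>map (\<lambda>y. c + s * y) ys. x - z)" for x
  proof -
    have "poly p x = poly (linear_product (map (\<lambda>x. x - c) xs)) (x - c)"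
      by (simp add: p poly_linear_product comp_def)
    also have "\<dots> = (x - c) ^ n + (\<Sum>k=2..n. (-1) ^ k * signed_coeff (centre p) k * (x - c) ^ (n - k))"
      unfolding ctr using n len sum_list_centred[of xs] by (intro centred_poly_eq) (auto simp: c)
    also have "\<dots> = (x - c) ^ n + (\<Sum>k=2..n. (-1) ^ k * (s ^ k * b k) * (x - c) ^ (n - k))"
      using b by simp
    also have "\<dots> = (\<Prod>y\<leftarrow>ys. x - c - s * y)"
      by (rule homogeneous_scaling[OF leny n q])
    finally show ?thesis by (simp add: comp_def diff_diff_eq)
  qed
  then show ?thesis unfolding c_def[symmetric] by (simp add: linear_product_eq_iff_poly)
qed

text \<open>
  After expanding $P(t)(x + c)$ in powers of $x + c$, all coefficients are polynomials in $c = a_1/n$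
  and the coefficients of $P$.
\<close>

lemma C_on_coeff_centre:
  assumes U: "open U" and P: "hyperbolic_curve_on U n P"
    and C: "\<And>i. C_on (enat m) (\<lambda>t. coeff (P t) i) U"
  shows "C_on (enat m) (\<lambda>t. coeff (centre (P t)) i) U"
proof -
  define c where "c t = (1 / n) * signed_coeff (P t) 1" for t
  have c: "C_on (enat m) c U"
    unfolding c_def by (intro C_on_mult C_on_const C_on_signed_coeff[where n = n] U P C)
  have pow: "C_on (enat m) (\<lambda>t. coeff ([:c t, 1:] ^ j) i) U" for i j
  proof (induction j arbitrary: i)
    case 0
    then show ?case using U by (auto intro: C_on_const)
  next
    case (Suc j)
    have eq: "coeff ([:c t, 1:] ^ Suc j) i = c t * coeff ([:c t, 1:] ^ j) i +
        (case i of 0 \<Rightarrow> 0 | Suc i' \<Rightarrow> coeff ([:c t, 1:] ^ j) i')" for t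
      by (simp add: coeff_pCons)
    show ?case unfolding eq
      by (cases i) (auto intro!: C_on_add C_on_mult C_on_const U c Suc)
  qed
  have "C_on (enat m) (\<lambda>t. \<Sum>j\<le>n. coeff (P t) j * coeff ([:c t, 1:] ^ j) i) U"
    by (intro C_on_sum C_on_mult U C pow)
  then show ?thesis
  proof (rule C_on_cong[OF U, rotated])
    fix t assume "t \<in> U"
    then have d: "degree (P t) = n" using P by (simp add: hyperbolic_curve_on_def)
    show "(\<Sum>j\<le>n. coeff (P t) j * coeff ([:c t, 1:] ^ j) i) = coeff (centre (P t)) i"
      unfolding centre_def d c_def by (simp add: pcompose_conv_sum[OF eq_refl[OF d]] coeff_sum)
  qed
qed

lemma C_on_signed_coeff_centre:
  assumes U: "open U" and P: "hyperbolic_curve_on U n P"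
    and C: "\<And>i. C_on (enat m) (\<lambda>t. coeff (P t) i) U"
  shows "C_on (enat m) (\<lambda>t. signed_coeff (centre (P t)) k) U"
proof (rule C_on_cong[OF U])
  show "C_on (enat m) (\<lambda>t. (-1) ^ k * coeff (centre (P t)) (n - k)) U"
    by (intro C_on_mult C_on_const C_on_coeff_centre[where n = n] assms)
qed (use P in \<open>auto simp: signed_coeff_def hyperbolic_curve_on_def centre_def degree_pcompose\<close>)

text \<open>
  The coefficient with index \<open>k\<close> is divided by $(t - t_0)^{kr}$ and loses $kr \le nr$
  derivatives.
\<close>

lemma C_coeffs_near_rescaled:
  assumes P: "hyperbolic_curve_near t0 n P" and C: "C_coeffs_near (enat (m + n * r)) t0 P"
    and U: "open U" "t0 \<in> U"
    and b: "\<And>k. k \<in> {2..n} \<Longrightarrow> continuous_on U (b k)"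
      "\<And>k t. k \<in> {2..n} \<Longrightarrow> t \<in> U \<Longrightarrow> signed_coeff (centre (P t)) k = (t - t0) ^ (k * r) * b k t"
  shows "C_coeffs_near (enat m) t0 (\<lambda>t. rescaled n (\<lambda>k. b k t))"
proof -
  obtain V where V: "open V" "t0 \<in> V" "hyperbolic_curve_on V n P"
    using P by (auto simp: hyperbolic_curve_near_def)
  obtain W where W: "open W" "t0 \<in> W" "\<And>i. C_on (enat (m + n * r)) (\<lambda>t. coeff (P t) i) W"
    using C by (auto simp: C_coeffs_near_def)
  have "open (U \<inter> V \<inter> W)" "t0 \<in> U \<inter> V \<inter> W" using U V W by auto
  then obtain e where e: "e > 0" "ball t0 e \<subseteq> U \<inter> V \<inter> W" using openE by blast
  let ?B = "ball t0 e"
  have bC: "C_on (enat m) (b k) ?B" if k: "k \<in> {2..n}" for k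
  proof (rule C_on_divide_power[of ?B t0 m "k * r" "\<lambda>t. signed_coeff (centre (P t)) k"])
    have "C_on (enat (m + n * r)) (\<lambda>t. signed_coeff (centre (P t)) k) ?B"
    proof (rule C_on_signed_coeff_centre[where n = n])
      show "hyperbolic_curve_on ?B n P"
        using V(3) by (rule hyperbolic_curve_on_subset) (use e in auto)
      show "C_on (enat (m + n * r)) (\<lambda>t. coeff (P t) i) ?B" for i
        using W(3) by (rule C_on_subset) (use e in auto)
    qed simp
    then show "C_on (enat (m + k * r)) (\<lambda>t. signed_coeff (centre (P t)) k) ?B"
      by (rule C_on_mono) (use k in auto)
    show "continuous_on ?B (b k)"
      using b(1)[OF k] by (rule continuous_on_subset) (use e in auto)
  qed (use b(2)[OF k] e in auto)
  have "C_on (enat m) (\<lambda>t. coeff (rescaled n (\<lambda>k. b k t)) i) ?B" for i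
  proof -
    have "C_on (enat m) (\<lambda>t. if n - k = i then (-1) ^ k * b k t else 0) ?B" if "k \<in> {2..n}" for k
      by (cases "n - k = i") (auto intro!: C_on_mult C_on_const bC[OF that])
    then show ?thesis
      unfolding coeff_rescaled by (intro C_on_add C_on_const C_on_sum) simp_all
  qed
  then show ?thesis unfolding C_coeffs_near_def using e(1) by (intro exI[of _ ?B]) simp
qed

text \<open>
  For $t \ne t_0$ the affine map $y \mapsto a_1/n + (t - t_0)^r y$ is a bijection between the
  roots of the rescaled polynomial and those of \<open>P\<close>, and it does not increase distances once
  $|t - t_0| \le 1$. So clusters and numbers of roots carry over.
\<close>

lemma root_dichotomy_rescaled:
  assumes P: "hyperbolic_curve_near t0 n P" and n: "n > 1"
    and C: "C_coeffs_near (enat p) t0 P"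
    and U: "open U" "t0 \<in> U"
    and b: "\<And>k t. k \<in> {2..n} \<Longrightarrow> t \<in> U \<Longrightarrow> signed_coeff (centre (P t)) k = (t - t0) ^ (k * r) * b k t"
    and Q: "hyperbolic_curve_near t0 n' (\<lambda>t. rescaled n (\<lambda>k. b k t))"
    and dich: "root_dichotomy p L t0 (\<lambda>t. rescaled n (\<lambda>k. b k t))"
  shows "root_dichotomy p L t0 P"
proof -
  let ?Q = "\<lambda>t. rescaled n (\<lambda>k. b k t)"
  define c where "c t = (1 / n) * signed_coeff (P t) 1" for t
  obtain V ls where V: "open V" "t0 \<in> V" "hyperbolic_curve_on V n P" "length ls = n"
    "\<And>t. t \<in> V \<Longrightarrow> P t = linear_product (map (\<lambda>l. l t) ls)"
    using hyperbolic_curve_near_roots[OF P] by metis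
  obtain W ms where W: "open W" "t0 \<in> W"
    "\<And>t. t \<in> W \<Longrightarrow> ?Q t = linear_product (map (\<lambda>l. l t) ms)"
    using hyperbolic_curve_near_roots[OF Q] by metis
  have trans: "P t = linear_product (map (\<lambda>y. c t + (t - t0) ^ r * y) ys)"
    if t: "t \<in> U" "t \<in> V" and ys: "?Q t = linear_product ys" for t ys
  proof -
    have "P t = linear_product (map (\<lambda>y. signed_coeff (P t) 1 / n + (t - t0) ^ r * y) ys)"
    proof (rule roots_of_rescaled[OF _ n V(5)[OF t(2)] _ ys])
      fix k assume "k \<in> {2..n}"
      then show "signed_coeff (centre (P t)) k = ((t - t0) ^ r) ^ k * b k t"
        using b t by (simp add: power_mult[symmetric] mult.commute)
    qed (simp add: V)
    then show ?thesis by (simp add: c_def)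
  qed
  have near: "\<forall>\<^sub>F t in at t0. t \<in> U \<inter> V \<inter> W"
    using U V W by (intro eventually_at_nhdsI eventually_nhds_open) auto
  have roots: "real_roots (P t) = (\<lambda>y. c t + (t - t0) ^ r * y) ` real_roots (?Q t)"
    if "t \<in> U \<inter> V \<inter> W" for t
  proof -
    have "P t = linear_product (map (\<lambda>y. c t + (t - t0) ^ r * y) (map (\<lambda>l. l t) ms))"
      using that by (intro trans W(3)) auto
    then have "real_roots (P t) = (\<lambda>y. c t + (t - t0) ^ r * y) ` set (map (\<lambda>l. l t) ms)"
      by (simp only: real_roots_linear_product set_map)
    moreover have "?Q t = linear_product (map (\<lambda>l. l t) ms)"
      using that by (intro W(3)) simp
    then have "real_roots (?Q t) = set (map (\<lambda>l. l t) ms)"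
      by (simp only: real_roots_linear_product)
    ultimately show ?thesis by simp
  qed
  have inj: "inj_on (\<lambda>y. c t + (t - t0) ^ r * y) A" if "t \<noteq> t0" for t A
    using that by (auto simp: inj_on_def)
  have card: "\<forall>\<^sub>F t in at t0. card (real_roots (P t)) = card (real_roots (?Q t))"
    using near eventually_neq_at_within[of t0]
  proof eventually_elim
    case (elim t)
    show ?case unfolding roots[OF elim(1)] by (rule card_image[OF inj[OF elim(2)]])
  qed
  have "clustered_roots L t0 P"
    unfolding clustered_roots_def
  proof
    fix N
    have small: "\<forall>\<^sub>F t in at t0. dist t t0 < 1"
      unfolding eventually_at by (intro exI[of _ 1]) auto
    have "\<forall>\<^sub>F t in at t0. \<forall>S \<subseteq> real_roots (?Q t). L < card S \<longrightarrow>
        (\<exists>x\<in>S. \<exists>y\<in>S. x \<noteq> y \<and> \<bar>x - y\<bar> \<le> \<bar>t - t0\<bar> ^ N)"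
      using dich by (simp add: root_dichotomy_def clustered_roots_def)
    then show "\<forall>\<^sub>F t in at t0. \<forall>S \<subseteq> real_roots (P t). L < card S \<longrightarrow>
        (\<exists>x\<in>S. \<exists>y\<in>S. x \<noteq> y \<and> \<bar>x - y\<bar> \<le> \<bar>t - t0\<bar> ^ N)"
      using near eventually_neq_at_within[of t0] small
    proof eventually_elim
      case (elim t)
      let ?f = "\<lambda>y. c t + (t - t0) ^ r * y"
      show ?case
      proof (intro allI impI)
        fix S assume S: "S \<subseteq> real_roots (P t)" "L < card S"
        then obtain T where T: "T \<subseteq> real_roots (?Q t)" "S = ?f ` T"
          unfolding roots[OF elim(2)] by (meson subset_imageE)
        then have "L < card T" using S(2) card_image[OF inj[OF elim(3)]] by simp
        then obtain x y where xy: "x \<in> T" "y \<in> T" "x \<noteq> y" "\<bar>x - y\<bar> \<le> \<bar>t - t0\<bar> ^ N"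
          using elim(1) T(1) by blast
        have "\<bar>?f x - ?f y\<bar> = \<bar>t - t0\<bar> ^ r * \<bar>x - y\<bar>"
          by (simp add: abs_mult power_abs flip: right_diff_distrib)
        also have "\<dots> \<le> 1 * \<bar>x - y\<bar>"
          using elim(4) by (intro mult_right_mono power_le_one) (auto simp: dist_real_def)
        finally have "\<bar>?f x - ?f y\<bar> \<le> \<bar>t - t0\<bar> ^ N" using xy(4) by simp
        moreover have "?f x \<noteq> ?f y" using xy(3) elim(3) by simp
        ultimately show "\<exists>x\<in>S. \<exists>y\<in>S. x \<noteq> y \<and> \<bar>x - y\<bar> \<le> \<bar>t - t0\<bar> ^ N"
          unfolding T(2) using xy(1,2) by blast
      qed
    qed
  qed
  moreover have "\<forall>\<^sub>F t in at t0. L \<le> card (real_roots (?Q t))"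
    using dich by (simp add: root_dichotomy_def)
  then have "\<forall>\<^sub>F t in at t0. L \<le> card (real_roots (P t))"
    using card by eventually_elim simp
  moreover have "(\<exists>\<^sub>F t in at t0. L < card (real_roots (P t))) \<or> C_roots_near p t0 P"
  proof (cases "\<exists>\<^sub>F t in at t0. L < card (real_roots (?Q t))")
    case True
    have "\<forall>\<^sub>F t in at t0. L < card (real_roots (?Q t)) \<longrightarrow> L < card (real_roots (P t))"
      using card by eventually_elim simp
    then show ?thesis using frequently_mp[OF _ True] by simp
  next
    case False
    then have "C_roots_near p t0 ?Q" using dich by (simp add: root_dichotomy_def)
    then obtain X ks where X: "open X" "t0 \<in> X" "\<And>l. l \<in> set ks \<Longrightarrow> C_on (enat p) l X"
        "\<And>t. t \<in> X \<Longrightarrow> ?Q t = linear_product (map (\<lambda>l. l t) ks)"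
      unfolding C_roots_near_def C_roots_on_def by blast
    obtain Y where Y: "open Y" "t0 \<in> Y" "\<And>i. C_on (enat p) (\<lambda>t. coeff (P t) i) Y"
      using C by (auto simp: C_coeffs_near_def)
    let ?Z = "U \<inter> V \<inter> X \<inter> Y"
    have Z: "open ?Z" "t0 \<in> ?Z" using U V X Y by auto
    have "C_on (enat p) c ?Z"
      unfolding c_def
    proof (intro C_on_mult C_on_const C_on_signed_coeff[where n = n] Z)
      show "hyperbolic_curve_on ?Z n P" using V(3) by (rule hyperbolic_curve_on_subset) auto
      show "C_on (enat p) (\<lambda>t. coeff (P t) i) ?Z" for i using Y(3) by (rule C_on_subset) auto
    qed
    then have "C_on (enat p) (\<lambda>t. c t + (t - t0) ^ r * l t) ?Z" if "l \<in> set ks" for l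
      using C_on_subset[OF X(3)[OF that], of ?Z] Z
      by (intro C_on_add C_on_mult C_on_power C_on_shift) auto
    moreover have "P t = linear_product (map (\<lambda>l. l t) (map (\<lambda>l t. c t + (t - t0) ^ r * l t) ks))"
      if "t \<in> ?Z" for t
      using trans[OF _ _ X(4)] that by (simp add: comp_def)
    ultimately have "C_roots_near p t0 P"
      unfolding C_roots_near_def C_roots_on_def using Z
      by (intro exI[of _ ?Z] conjI exI[of _ "map (\<lambda>l t. c t + (t - t0) ^ r * l t) ks"]) auto
    then show ?thesis ..
  qed
  ultimately show ?thesis unfolding root_dichotomy_def by blast
qed

section \<open>Induction along the recursion\<close>

lemma Gamma_gamma_curve: "Gamma_gamma t0 P G g \<Longrightarrow> \<exists>n. hyperbolic_curve_near t0 n P"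
  by (induction rule: Gamma_gamma.induct) blast+

text \<open>
  In the splitting step both factors inherit the regularity of \<open>P\<close>, and $G$ is the maximum of
  their values. In the rescaling step the loss of $nr$ derivatives is compensated by the growth
  of $G$.
\<close>

lemma Gamma_gamma_imp_root_dichotomy:
  assumes "Gamma_gamma t0 P G g" "C_coeffs_near (enat (p + G)) t0 P"
  shows "\<exists>L. root_dichotomy p L t0 P"
  using assms
proof (induction rule: Gamma_gamma.induct)
  case (split n P n1 P1 n2 P2 G1 g1 G2 g2 G)
  have "C_coeffs_near (enat (p + G)) t0 P1" "C_coeffs_near (enat (p + G)) t0 P2"
    using split.hyps split.prems by blast+
  then have "C_coeffs_near (enat (p + G1)) t0 P1" "C_coeffs_near (enat (p + G2)) t0 P2"
    using split.hyps by (auto intro: C_coeffs_near_mono)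
  then obtain L1 L2 where "root_dichotomy p L1 t0 P1" "root_dichotomy p L2 t0 P2"
    using split.IH by blast
  then show ?case
    using root_dichotomy_product split.hyps by blast
next
  case (rescale n P r U b G g)
  have eq: "(\<lambda>t. monom 1 n + (\<Sum>k=2..n. monom ((-1) ^ k * b k t) (n - k))) = (\<lambda>t. rescaled n (\<lambda>k. b k t))"
    by (simp add: rescaled_def)
  have "C_coeffs_near (enat (p + G)) t0 (\<lambda>t. rescaled n (\<lambda>k. b k t))"
    using rescale.hyps rescale.prems
    by (intro C_coeffs_near_rescaled[where P = P and r = r and U = U]) (auto simp: add.assoc)
  then obtain L where L: "root_dichotomy p L t0 (\<lambda>t. rescaled n (\<lambda>k. b k t))"
    using rescale.IH unfolding eq by blast
  obtain n' where n': "hyperbolic_curve_near t0 n' (\<lambda>t. rescaled n (\<lambda>k. b k t))"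
    using Gamma_gamma_curve rescale.hyps unfolding eq by blast
  have "C_coeffs_near (enat p) t0 P"
    using rescale.prems by (rule C_coeffs_near_mono) simp
  then have "root_dichotomy p L t0 P"
    using rescale.hyps by (intro root_dichotomy_rescaled[OF _ _ _ _ _ _ n' L, where U = U and r = r]) auto
  then show ?case ..
next
  case (flat n P)
  then show ?case
    using root_dichotomy_flat[of t0 n P p] multiplicity_infinite_imp_flat by auto
next
  case (linear P)
  then show ?case using root_dichotomy_linear[of t0 P p] by auto
qed

section \<open>The functions $\tilde\Delta_k$ of the roots\<close>

definition index_pairs :: "nat set \<Rightarrow> (nat \<times> nat) set" where
  "index_pairs S = {(i, j). i \<in> S \<and> j \<in> S \<and> i < j}"

text \<open>
  The value of \<open>Delta_tilde\<close> as a function of the sorted list of roots. This form shows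
  continuity and the estimates.
\<close>

definition Delta_list :: "nat \<Rightarrow> real list \<Rightarrow> real" where
  "Delta_list k xs = (\<Sum>S | S \<subseteq> {..<length xs} \<and> card S = k.
     \<Prod>(i, j)\<in>index_pairs S. (xs ! i - xs ! j)\<^sup>2)"

lemma Delta_tilde_linear_product:
  "sorted xs \<Longrightarrow> Delta_tilde k (linear_product xs) = Delta_list k xs"
  unfolding Delta_tilde_def Delta_list_def index_pairs_def
  by (simp only: sorted_roots_linear_product Let_def)

lemma finite_index_pairs: "finite S \<Longrightarrow> finite (index_pairs S)"
  unfolding index_pairs_def by (rule finite_subset[of _ "S \<times> S"]) auto

lemma finite_index_sets: "finite {S. S \<subseteq> {..<n::nat} \<and> card S = k}"
  by (rule finite_subset[of _ "Pow {..<n}"]) auto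

lemma prod_index_pairs_nonneg:
  "(\<Prod>(i, j)\<in>index_pairs S. ((xs ! i - xs ! j) :: real)\<^sup>2) \<ge> 0"
  by (rule prod_nonneg) auto

lemma prod_index_pairs_eq_0_iff:
  assumes "finite S"
  shows "(\<Prod>(i, j)\<in>index_pairs S. ((xs ! i - xs ! j) :: real)\<^sup>2) = 0 \<longleftrightarrow> \<not> inj_on ((!) xs) S"
proof -
  have "(\<Prod>(i, j)\<in>index_pairs S. (xs ! i - xs ! j)\<^sup>2) = 0 \<longleftrightarrow>
      (\<exists>i j. i \<in> S \<and> j \<in> S \<and> i < j \<and> xs ! i = xs ! j)"
    unfolding prod_zero_iff[OF finite_index_pairs[OF assms]] by (auto simp: index_pairs_def)
  also have "\<dots> \<longleftrightarrow> \<not> inj_on ((!) xs) S"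
  proof
    assume "\<not> inj_on ((!) xs) S"
    then obtain i j where ij: "i \<in> S" "j \<in> S" "xs ! i = xs ! j" "i \<noteq> j"
      unfolding inj_on_def by blast
    then show "\<exists>i j. i \<in> S \<and> j \<in> S \<and> i < j \<and> xs ! i = xs ! j"
      by (cases "i < j") (force simp: not_less)+
  qed (auto simp: inj_on_def)
  finally show ?thesis .
qed

text \<open>
  A summand is nonzero exactly if the chosen roots are pairwise distinct, and summands are
  nonnegative and do not cancel.
\<close>

lemma Delta_list_eq_0_iff: "Delta_list k xs = 0 \<longleftrightarrow> card (set xs) < k"
proof -
  have "Delta_list k xs = 0 \<longleftrightarrow>
      (\<forall>S. S \<subseteq> {..<length xs} \<and> card S = k \<longrightarrow> \<not> inj_on ((!) xs) S)"
    unfolding Delta_list_def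
    by (subst sum_nonneg_eq_0_iff[OF finite_index_sets prod_index_pairs_nonneg])
      (auto simp: prod_index_pairs_eq_0_iff finite_subset[OF _ finite_lessThan])
  also have "\<dots> \<longleftrightarrow> card (set xs) < k"
  proof
    assume none: "\<forall>S. S \<subseteq> {..<length xs} \<and> card S = k \<longrightarrow> \<not> inj_on ((!) xs) S"
    have "set xs \<subseteq> (!) xs ` {..<length xs}"
      by (auto simp: set_conv_nth)
    then obtain T where T: "T \<subseteq> {..<length xs}" "inj_on ((!) xs) T" "set xs = (!) xs ` T"
      unfolding subset_image_inj by blast
    then have card: "card T = card (set xs)" by (simp add: card_image)
    show "card (set xs) < k"
    proof (rule ccontr)
      assume "\<not> card (set xs) < k"
      then obtain S where "S \<subseteq> T" "card S = k"
        using obtain_subset_with_card_n[of k T] card by (metis not_less)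
      moreover from this have "inj_on ((!) xs) S" using inj_on_subset[OF T(2)] by blast
      ultimately show False using none T(1) by blast
    qed
  next
    assume less: "card (set xs) < k"
    show "\<forall>S. S \<subseteq> {..<length xs} \<and> card S = k \<longrightarrow> \<not> inj_on ((!) xs) S"
    proof (intro allI impI notI)
      fix S assume S: "S \<subseteq> {..<length xs} \<and> card S = k" "inj_on ((!) xs) S"
      then have "(!) xs ` S \<subseteq> set xs" by auto
      then have "card ((!) xs ` S) \<le> card (set xs)" by (intro card_mono) simp
      then have "card S \<le> card (set xs)" using card_image[OF S(2)] by simp
      then show False using less S by simp
    qed
  qed
  finally show ?thesis .
qed

lemma Delta_list_nonneg: "Delta_list k xs \<ge> 0"
  unfolding Delta_list_def by (intro sum_nonneg prod_index_pairs_nonneg)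

text \<open>
  A summand that does not vanish belongs to \<open>k\<close> distinct roots, two of which are close, and this
  pair contributes a factor of at most $e^2$. The other factors are at most \<open>B\<close>. There are at most
  $2^n$ summands with at most $n^2$ factors each.
\<close>

lemma Delta_list_le:
  assumes close: "\<And>S. S \<subseteq> set xs \<Longrightarrow> k \<le> card S \<Longrightarrow> \<exists>x\<in>S. \<exists>y\<in>S. x \<noteq> y \<and> \<bar>x - y\<bar> \<le> e"
    and B: "\<And>x y. x \<in> set xs \<Longrightarrow> y \<in> set xs \<Longrightarrow> (x - y)\<^sup>2 \<le> B" "B \<ge> 1"
    and e: "e \<ge> 0"
  shows "Delta_list k xs \<le> 2 ^ length xs * (e\<^sup>2 * B ^ (length xs)\<^sup>2)"
proof -
  let ?n = "length xs"
  have le: "(\<Prod>(i, j)\<in>index_pairs S. (xs ! i - xs ! j)\<^sup>2) \<le> e\<^sup>2 * B ^ ?n\<^sup>2"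
    if S: "S \<subseteq> {..<?n}" "card S = k" for S
  proof (cases "inj_on ((!) xs) S")
    case False
    then have "(\<Prod>(i, j)\<in>index_pairs S. (xs ! i - xs ! j)\<^sup>2) = 0"
      using prod_index_pairs_eq_0_iff[of S xs] finite_subset[OF S(1)] by simp
    then show ?thesis using B(2) by simp
  next
    case True
    have fin: "finite (index_pairs S)"
      using finite_subset[OF S(1)] by (intro finite_index_pairs) simp
    have "(!) xs ` S \<subseteq> set xs" "k \<le> card ((!) xs ` S)"
      using S True by (auto simp: card_image)
    then obtain x y where xy: "x \<in> (!) xs ` S" "y \<in> (!) xs ` S" "x \<noteq> y" "\<bar>x - y\<bar> \<le> e"
      using close by blast
    then obtain i' j' where ij': "i' \<in> S" "j' \<in> S" "i' \<noteq> j'" "\<bar>xs ! i' - xs ! j'\<bar> \<le> e"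
      by auto
    have "\<exists>i j. i \<in> S \<and> j \<in> S \<and> i < j \<and> \<bar>xs ! i - xs ! j\<bar> \<le> e"
    proof (cases "i' < j'")
      case True
      then show ?thesis using ij' by blast
    next
      case False
      then have "j' < i'" "\<bar>xs ! j' - xs ! i'\<bar> \<le> e" using ij' by (auto simp: abs_minus_commute)
      then show ?thesis using ij' by blast
    qed
    then obtain i j where ij: "i \<in> S" "j \<in> S" "i < j" "\<bar>xs ! i - xs ! j\<bar> \<le> e"
      by blast
    then have mem: "(i, j) \<in> index_pairs S" by (simp add: index_pairs_def)
    have "index_pairs S - {(i, j)} \<subseteq> {..<?n} \<times> {..<?n}"
      using S(1) by (auto simp: index_pairs_def)
    then have "card (index_pairs S - {(i, j)}) \<le> card ({..<?n} \<times> {..<?n})"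
      by (intro card_mono) auto
    then have card: "card (index_pairs S - {(i, j)}) \<le> ?n\<^sup>2"
      by (simp add: power2_eq_square)
    have "(\<Prod>(i, j)\<in>index_pairs S - {(i, j)}. (xs ! i - xs ! j)\<^sup>2) \<le> (\<Prod>_\<in>index_pairs S - {(i, j)}. B)"
      using S(1) by (intro prod_mono) (auto simp: index_pairs_def intro!: B(1))
    also have "\<dots> \<le> B ^ ?n\<^sup>2"
      using card B(2) by (simp add: power_increasing)
    finally have rest: "(\<Prod>(i, j)\<in>index_pairs S - {(i, j)}. (xs ! i - xs ! j)\<^sup>2) \<le> B ^ ?n\<^sup>2" .
    have "(xs ! i - xs ! j)\<^sup>2 \<le> e\<^sup>2"
      using ij(4) e by (simp add: abs_le_square_iff[symmetric])
    then show ?thesis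
      unfolding prod.remove[OF fin mem] using rest
      by (simp only: case_prod_conv) (intro mult_mono prod_nonneg, auto)
  qed
  have "Delta_list k xs \<le> (\<Sum>S | S \<subseteq> {..<?n} \<and> card S = k. e\<^sup>2 * B ^ ?n\<^sup>2)"
    unfolding Delta_list_def by (intro sum_mono) (use le in auto)
  also have "\<dots> = real (card {S. S \<subseteq> {..<?n} \<and> card S = k}) * (e\<^sup>2 * B ^ ?n\<^sup>2)"
    by simp
  also have "\<dots> \<le> 2 ^ ?n * (e\<^sup>2 * B ^ ?n\<^sup>2)"
  proof (rule mult_right_mono)
    have "card {S. S \<subseteq> {..<?n} \<and> card S = k} \<le> card (Pow {..<?n})"
      by (intro card_mono) auto
    then show "real (card {S. S \<subseteq> {..<?n} \<and> card S = k}) \<le> 2 ^ ?n"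
      by (simp add: card_Pow)
  qed (use B(2) in simp)
  finally show ?thesis .
qed

lemma continuous_on_Delta_list:
  assumes "\<And>l. l \<in> set ls \<Longrightarrow> continuous_on U l"
  shows "continuous_on U (\<lambda>t. Delta_list k (map (\<lambda>l. l t) ls))"
proof -
  have "continuous_on U (\<lambda>t. map (\<lambda>l. l t) ls ! i)" if "i < length ls" for i
    using that assms by simp
  then show ?thesis
    unfolding Delta_list_def length_map
    by (intro continuous_on_sum continuous_on_prod)
      (auto intro!: continuous_intros simp: index_pairs_def case_prod_unfold subset_eq)
qed

section \<open>Excluding additional roots\<close>

text \<open>
  If more than \<open>L\<close> distinct roots occurred arbitrarily near \<open>t0\<close>, then $\tilde\Delta_{L+1}$ would
  have a nonzero germ. The maximal $s$ with this property exceeds \<open>L\<close>, so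
  $\tilde\Delta_s$ involves a pair of infinitely close roots in each summand and is flat.
\<close>

lemma no_extra_roots:
  assumes I: "open I" "t0 \<in> I" and P: "hyperbolic_curve_on I n P"
    and E: "t0 \<notin> E_infinity I P" and cl: "clustered_roots L t0 P"
  shows "\<not> (\<exists>\<^sub>F t in at t0. L < card (real_roots (P t)))"
proof
  assume many: "\<exists>\<^sub>F t in at t0. L < card (real_roots (P t))"
  obtain ls where ls: "length ls = n" "\<And>l. l \<in> set ls \<Longrightarrow> continuous_on I l"
    "\<And>t. t \<in> I \<Longrightarrow> sorted (map (\<lambda>l. l t) ls)"
    "\<And>t. t \<in> I \<Longrightarrow> P t = linear_product (map (\<lambda>l. l t) ls)"
    using hyperbolic_curve_sorted_roots[OF P] by metis
  define xs where "xs t = map (\<lambda>l. l t) ls" for t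
  have PI: "P t = linear_product (xs t)" and len: "length (xs t) = n" if "t \<in> I" for t
    using ls that by (simp_all add: xs_def)
  have Delta: "Delta_tilde k (P t) = Delta_list k (xs t)" if "t \<in> I" for k t
    using Delta_tilde_linear_product[OF ls(3)[OF that]] ls(4)[OF that] by (simp add: xs_def)
  have deg: "degree (P t0) = n" using P I(2) by (simp add: hyperbolic_curve_on_def)
  have inI: "\<forall>\<^sub>F t in at t0. t \<in> I"
    by (intro eventually_at_nhdsI eventually_nhds_open I)
  \<comment> \<open>The indices with nonzero germ; the maximal one is the \<open>s\<close> in the definition of \<open>E_infinity\<close>.\<close>
  define K where "K = {k \<in> {1..n}. \<not> (\<forall>\<^sub>F u in nhds t0. Delta_tilde k (P u) = 0)}"
  have "Suc L \<in> K"
  proof -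
    have "\<exists>\<^sub>F t in at t0. L < card (real_roots (P t)) \<and> t \<in> I"
      using many inI by (rule frequently_eventually_frequently)
    then obtain t where t: "t \<in> I" "L < card (real_roots (P t))"
      using frequently_ex by blast
    then have "L < card (set (xs t))" using PI real_roots_linear_product by metis
    also have "\<dots> \<le> n" using len[OF t(1)] card_length[of "xs t"] by simp
    finally have "Suc L \<in> {1..n}" by simp
    moreover have "\<not> (\<forall>\<^sub>F u in nhds t0. Delta_tilde (Suc L) (P u) = 0)"
    proof
      assume "\<forall>\<^sub>F u in nhds t0. Delta_tilde (Suc L) (P u) = 0"
      then have "\<forall>\<^sub>F u in at t0. Delta_tilde (Suc L) (P u) = 0" by (rule eventually_at_nhdsI)
      then have "\<forall>\<^sub>F t in at t0. \<not> L < card (real_roots (P t))"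
        using inI
      proof eventually_elim
        case (elim t)
        then have "card (set (xs t)) < Suc L" by (metis Delta Delta_list_eq_0_iff)
        then show ?case unfolding PI[OF elim(2)] real_roots_linear_product by simp
      qed
      then show False using many by (simp add: frequently_def)
    qed
    ultimately show ?thesis by (simp add: K_def)
  qed
  moreover have finK: "finite K" by (simp add: K_def)
  ultimately have s: "Max K \<in> K" "Suc L \<le> Max K" by (auto intro: Max_in Max_ge)
  define s where "s = Max K"
  have "\<forall>k \<in> {s<..n}. \<forall>\<^sub>F u in nhds t0. Delta_tilde k (P u) = 0"
  proof
    fix k assume k: "k \<in> {s<..n}"
    then have "k \<notin> K" using Max_ge[OF finK, of k] by (auto simp: s_def)
    then show "\<forall>\<^sub>F u in nhds t0. Delta_tilde k (P u) = 0" using k by (auto simp: K_def)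
  qed
  moreover have "flat_at t0 (\<lambda>u. Delta_tilde s (P u))"
  proof (rule flat_atI)
    fix N
    have "\<forall>\<^sub>F t in at t0. \<bar>l t\<bar> < \<bar>l t0\<bar> + 1" if "l \<in> set ls" for l
    proof -
      have "(l \<longlongrightarrow> l t0) (at t0)"
        using ls(2)[OF that] I by (simp add: continuous_on_eq_continuous_at isCont_def)
      then show ?thesis by (intro order_tendstoD(2)[OF tendsto_rabs]) auto
    qed
    then have near: "\<forall>\<^sub>F t in at t0. \<forall>l\<in>set ls. \<bar>l t\<bar> < \<bar>l t0\<bar> + 1"
      by (simp add: eventually_ball_finite)
    define M where "M = (\<Sum>l\<leftarrow>ls. \<bar>l t0\<bar>) + 1"
    have M: "\<bar>l t0\<bar> + 1 \<le> M" if "l \<in> set ls" for l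
    proof -
      have "\<bar>l t0\<bar> \<le> (\<Sum>l\<leftarrow>ls. \<bar>l t0\<bar>)"
        by (intro member_le_sum_list) (use that in auto)
      then show ?thesis by (simp add: M_def)
    qed
    have "(\<Sum>l\<leftarrow>ls. \<bar>l t0\<bar>) \<ge> 0" by (intro sum_list_nonneg) auto
    then have M1: "M \<ge> 1" by (simp add: M_def)
    \<comment> \<open>Near \<open>t0\<close> all roots are bounded by \<open>M\<close>, hence their squared differences by \<open>B\<close>.\<close>
    define B where "B = (2 * M)\<^sup>2"
    have B1: "B \<ge> 1" unfolding B_def using M1 by (intro one_le_power) simp
    have cls: "\<forall>\<^sub>F t in at t0. \<forall>S \<subseteq> real_roots (P t). L < card S \<longrightarrow>
     (\<exists>x\<in>S. \<exists>y\<in>S. x \<noteq> y \<and> \<bar>x - y\<bar> \<le> \<bar>t - t0\<bar> ^ N)"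
      using cl by (simp add: clustered_roots_def)
    have small: "\<forall>\<^sub>F t in at t0. dist t t0 < 1"
      unfolding eventually_at by (intro exI[of _ 1]) auto
    have "\<forall>\<^sub>F t in at t0. \<bar>Delta_tilde s (P t)\<bar> \<le> (2 ^ n * B ^ n\<^sup>2) * \<bar>t - t0\<bar> ^ N"
      using near inI cls small
    proof eventually_elim
      case (elim t)
      have bound: "\<bar>x\<bar> \<le> M" if "x \<in> set (xs t)" for x
        using that elim(1) M unfolding xs_def by fastforce
      have "\<bar>Delta_tilde s (P t)\<bar> = Delta_list s (xs t)"
        using Delta[OF elim(2)] Delta_list_nonneg by simp
      also have "\<dots> \<le> 2 ^ length (xs t) * ((\<bar>t - t0\<bar> ^ N)\<^sup>2 * B ^ (length (xs t))\<^sup>2)"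
      proof (rule Delta_list_le)
        fix S assume "S \<subseteq> set (xs t)" "s \<le> card S"
        then show "\<exists>x\<in>S. \<exists>y\<in>S. x \<noteq> y \<and> \<bar>x - y\<bar> \<le> \<bar>t - t0\<bar> ^ N"
          using elim(3) s(2) unfolding PI[OF elim(2)] real_roots_linear_product s_def by simp
      next
        fix x y assume "x \<in> set (xs t)" "y \<in> set (xs t)"
        then have "\<bar>x - y\<bar> \<le> \<bar>2 * M\<bar>" using bound[of x] bound[of y] by simp
        then show "(x - y)\<^sup>2 \<le> B" unfolding B_def abs_le_square_iff .
      qed (use B1 in auto)
      also have "\<dots> = (2 ^ n * B ^ n\<^sup>2) * (\<bar>t - t0\<bar> ^ N)\<^sup>2" using len[OF elim(2)] by simp
      also have "\<dots> \<le> (2 ^ n * B ^ n\<^sup>2) * \<bar>t - t0\<bar> ^ N"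
      proof (rule mult_left_mono)
        have "\<bar>t - t0\<bar> ^ N \<le> 1" using elim(4) by (intro power_le_one) (auto simp: dist_real_def)
        then show "(\<bar>t - t0\<bar> ^ N)\<^sup>2 \<le> \<bar>t - t0\<bar> ^ N"
          unfolding power2_eq_square by (intro mult_left_le) auto
      qed (use B1 in auto)
      finally show ?case .
    qed
    then show "\<exists>C. \<forall>\<^sub>F t in at t0. \<bar>Delta_tilde s (P t)\<bar> \<le> C * \<bar>t - t0\<bar> ^ N" ..
  qed
  moreover have "continuous_on I (\<lambda>u. Delta_tilde s (P u))"
    using continuous_on_Delta_list[of ls I s, OF ls(2)] Delta by (simp add: xs_def cong: continuous_on_cong)
  ultimately have "multiplicity_at t0 (\<lambda>u. Delta_tilde s (P u)) = \<infinity>"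
    "\<forall>k \<in> {s<..n}. \<forall>\<^sub>F u in nhds t0. Delta_tilde k (P u) = 0"
    using flat_imp_multiplicity_infinite I by blast+
  moreover have "s \<in> {1..n}" "\<not> (\<forall>\<^sub>F u in nhds t0. Delta_tilde s (P u) = 0)"
    using s(1) by (simp_all add: K_def s_def)
  ultimately have "t0 \<in> E_infinity I P"
    unfolding E_infinity_def using I(2) deg by auto
  then show False using E by simp
qed

section \<open>Gluing root systems\<close>

text \<open>
  Functions with different values at \<open>c\<close> keep different values nearby. If the number of values does
  not grow, there is no room for functions with the same value at \<open>c\<close> to separate.
\<close>

lemma eventually_keep_equal:
  fixes F :: "('a::topological_space \<Rightarrow> real) set"
  assumes fin: "finite F" and cont: "\<And>f. f \<in> F \<Longrightarrow> (f \<longlongrightarrow> f c) (nhds c)"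
    and card: "\<forall>\<^sub>F t in nhds c. card ((\<lambda>f. f t) ` F) = card ((\<lambda>f. f c) ` F)"
  shows "\<forall>\<^sub>F t in nhds c. \<forall>f\<in>F. \<forall>g\<in>F. f c = g c \<longrightarrow> f t = g t"
proof -
  have "\<forall>\<^sub>F t in nhds c. f c \<noteq> g c \<longrightarrow> f t \<noteq> g t" if "f \<in> F" "g \<in> F" for f g
  proof (cases "f c = g c")
    case False
    have "((\<lambda>t. f t - g t) \<longlongrightarrow> f c - g c) (nhds c)"
      by (intro tendsto_diff cont that)
    moreover have "f c - g c \<noteq> 0" using False by simp
    ultimately have "\<forall>\<^sub>F t in nhds c. f t - g t \<noteq> 0" by (rule tendsto_imp_eventually_ne)
    then show ?thesis by eventually_elim simp
  qed simp
  then have "\<forall>\<^sub>F t in nhds c. \<forall>f\<in>F. \<forall>g\<in>F. f c \<noteq> g c \<longrightarrow> f t \<noteq> g t"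
    using fin by (simp add: eventually_ball_finite)
  then show ?thesis
    using card
  proof eventually_elim
    case (elim t)
    \<comment> \<open>At \<open>t\<close>, the value \<open>f t\<close> determines \<open>f c\<close>. This gives a surjection from the values at \<open>t\<close> to
      those at \<open>c\<close>, which is injective since the finite cardinalities agree.\<close>
    define h where "h v = (SOME y. \<exists>f\<in>F. f t = v \<and> f c = y)" for v
    have h: "h (f t) = f c" if "f \<in> F" for f
    proof -
      have "\<exists>g\<in>F. g t = f t \<and> g c = h (f t)"
        unfolding h_def by (rule someI[where x = "f c"]) (use that in blast)
      then show ?thesis using elim(1) that by metis
    qed
    have "h ` (\<lambda>f. f t) ` F = (\<lambda>f. f c) ` F"
      unfolding image_image using h by (intro image_cong) auto
    then have "inj_on h ((\<lambda>f. f t) ` F)"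
      using elim(2) fin by (intro eq_card_imp_inj_on) auto
    then show ?case using h by (metis image_eqI inj_onD)
  qed
qed

lemma reorder_functions:
  assumes "mset (map g ys) = mset zs"
  shows "\<exists>ys'. mset ys' = mset ys \<and> map g ys' = zs"
  using assms
proof (induction zs arbitrary: ys)
  case (Cons z zs)
  then have "z \<in> set (map g ys)" by (metis list.set_intros(1) mset_eq_setD)
  then obtain y where y: "y \<in> set ys" "g y = z" by auto
  then have "mset (map g (remove1 y ys)) = mset zs"
    using Cons.prems by (simp add: image_mset_Diff)
  then obtain ys' where "mset ys' = mset (remove1 y ys)" "map g ys' = zs"
    using Cons.IH by blast
  then have "mset (y # ys') = mset ys" "map g (y # ys') = z # zs"
    using y by simp_all
  then show ?case by (intro exI[of _ "y # ys'"] conjI)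
next
  case Nil
  then show ?case by (intro exI[of _ "[]"]) simp
qed

text \<open>
  The root system on the right is permuted to agree at \<open>c\<close> with the one on the left. As the number
  of distinct roots is constant near \<open>c\<close>, both then agree in a whole neighbourhood, so the functions
  obtained by switching at \<open>c\<close> coincide locally with one of the given $C^p$ functions.
\<close>

lemma glue_C_roots:
  assumes A: "open A" "is_interval A" and B: "open B" "is_interval B" and c: "c \<in> A" "c \<in> B"
    and pA: "C_roots_on p A P" and pB: "C_roots_on p B P"
    and L: "\<forall>\<^sub>F t in nhds c. card (real_roots (P t)) = L"
  shows "\<exists>I'. open I' \<and> is_interval I' \<and> I' = (A \<inter> {..c}) \<union> (B \<inter> {c..}) \<and> C_roots_on p I' P"
proof -
  define I' where "I' = (A \<inter> {..c}) \<union> (B \<inter> {c..})"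
  \<comment> \<open>The summand \<open>A \<inter> B\<close> is an open neighbourhood of the seam \<open>c\<close> and shows that \<open>I'\<close> is open.\<close>
  have "I' = (A \<inter> {..<c}) \<union> (B \<inter> {c<..}) \<union> (A \<inter> B)"
  proof (rule set_eqI)
    show "x \<in> I' \<longleftrightarrow> x \<in> (A \<inter> {..<c}) \<union> (B \<inter> {c<..}) \<union> (A \<inter> B)" for x
      using c unfolding I'_def by (cases x c rule: linorder_cases) auto
  qed
  then have "open I'"
    by (simp only:) (intro open_Un open_Int A B open_lessThan open_greaterThan)
  moreover have "is_interval I'"
    unfolding is_interval_1
  proof (intro ballI allI impI)
    fix a b x assume ab: "a \<in> I'" "b \<in> I'" and x: "a \<le> x \<and> x \<le> b"
    show "x \<in> I'"
    proof (cases "x \<le> c")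
      case True
      then have "a \<in> A" using ab(1) x c unfolding I'_def by (cases "a = c") auto
      then have "x \<in> A" using A(2) c(1) x True unfolding is_interval_1 by blast
      then show ?thesis using True by (simp add: I'_def)
    next
      case False
      then have "b \<in> B" using ab(2) x c unfolding I'_def by auto
      moreover have "c \<le> x" using False by simp
      ultimately have "x \<in> B" using B(2) c(2) x unfolding is_interval_1 by blast
      then show ?thesis using False by (simp add: I'_def)
    qed
  qed
  moreover have "C_roots_on p I' P"
  proof -
    obtain ls where ls: "\<And>l. l \<in> set ls \<Longrightarrow> C_on (enat p) l A"
        "\<And>t. t \<in> A \<Longrightarrow> P t = linear_product (map (\<lambda>l. l t) ls)"
      using pA unfolding C_roots_on_def by blast
    obtain ms0 where ms0: "\<And>l. l \<in> set ms0 \<Longrightarrow> C_on (enat p) l B"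
        "\<And>t. t \<in> B \<Longrightarrow> P t = linear_product (map (\<lambda>l. l t) ms0)"
      using pB unfolding C_roots_on_def by blast
    have "mset (map (\<lambda>l. l c) ms0) = mset (map (\<lambda>l. l c) ls)"
      using ls(2)[OF c(1)] ms0(2)[OF c(2)] proots_linear_product by metis
    then obtain ms where ms: "mset ms = mset ms0" and msc: "map (\<lambda>l. l c) ms = map (\<lambda>l. l c) ls"
      using reorder_functions by blast
    have msC: "C_on (enat p) l B" if "l \<in> set ms" for l
      using that ms0(1) ms by (metis mset_eq_setD)
    have msP: "P t = linear_product (map (\<lambda>l. l t) ms)" if "t \<in> B" for t
      unfolding ms0(2)[OF that] by (rule linear_product_cong_mset) (simp add: ms)
    have len: "length ms = length ls" using msc by (metis length_map)
    let ?F = "set ls \<union> set ms"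
    have root_values: "(\<lambda>f. f t) ` ?F = real_roots (P t)" if "t \<in> A \<inter> B" for t
    proof -
      have t: "t \<in> A" "t \<in> B" using that by auto
      have "real_roots (P t) = set (map (\<lambda>l. l t) ls)"
        unfolding ls(2)[OF t(1)] by (rule real_roots_linear_product)
      moreover have "real_roots (P t) = set (map (\<lambda>l. l t) ms)"
        unfolding msP[OF t(2)] by (rule real_roots_linear_product)
      ultimately show ?thesis by (simp add: image_Un)
    qed
    have nearAB: "\<forall>\<^sub>F t in nhds c. t \<in> A \<inter> B"
      using A B c by (intro eventually_nhds_open) auto
    have Lc: "card (real_roots (P c)) = L" using L by (rule eventually_nhds_x_imp_x)
    have "\<forall>\<^sub>F t in nhds c. card ((\<lambda>f. f t) ` ?F) = card ((\<lambda>f. f c) ` ?F)"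
      using L nearAB
    proof eventually_elim
      case (elim t)
      have "c \<in> A \<inter> B" using c by simp
      then show ?case unfolding root_values[OF elim(2)] by (simp only: root_values elim(1) Lc)
    qed
    moreover have "(f \<longlongrightarrow> f c) (nhds c)" if "f \<in> ?F" for f
    proof -
      have "isCont f c"
        using that
      proof
        assume "f \<in> set ls"
        then show ?thesis using C_on_imp_continuous_on[OF ls(1)] A(1) c(1)
          by (simp add: continuous_on_eq_continuous_at)
      next
        assume "f \<in> set ms"
        then show ?thesis using C_on_imp_continuous_on[OF msC] B(1) c(2)
          by (simp add: continuous_on_eq_continuous_at)
      qed
      then show ?thesis by (simp add: isCont_def tendsto_at_iff_tendsto_nhds)
    qed
    ultimately have "\<forall>\<^sub>F t in nhds c. \<forall>f\<in>?F. \<forall>g\<in>?F. f c = g c \<longrightarrow> f t = g t"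
      by (intro eventually_keep_equal) auto
    then have "\<forall>\<^sub>F t in nhds c. t \<in> A \<inter> B \<and> (\<forall>f\<in>?F. \<forall>g\<in>?F. f c = g c \<longrightarrow> f t = g t)"
      using nearAB by eventually_elim simp
    then obtain V where V: "open V" "c \<in> V" "V \<subseteq> A \<inter> B"
        and agree: "\<And>t f g. t \<in> V \<Longrightarrow> f \<in> ?F \<Longrightarrow> g \<in> ?F \<Longrightarrow> f c = g c \<Longrightarrow> f t = g t"
      unfolding eventually_nhds by blast
    have same: "(ls ! i) t = (ms ! i) t" if "t \<in> V" "i < length ls" for t i
    proof (rule agree[OF that(1)])
      show "(ls ! i) c = (ms ! i) c"
        using arg_cong[OF msc, of "\<lambda>zs. zs ! i"] that(2) len by simp
    qed (use that(2) len in auto)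
    define ks where "ks = map (\<lambda>i t. if t \<le> c then (ls ! i) t else (ms ! i) t) [0..<length ls]"
    have "C_on (enat p) k I'" if k: "k \<in> set ks" for k
    proof -
      obtain i where i: "i < length ls" "k = (\<lambda>t. if t \<le> c then (ls ! i) t else (ms ! i) t)"
        using k by (auto simp: ks_def)
      have Cl: "C_on (enat p) (ls ! i) A" and Cm: "C_on (enat p) (ms ! i) B"
        using ls(1) msC i(1) len by simp_all
      show ?thesis
      proof (rule C_on_locally)
        fix x assume x: "x \<in> I'"
        consider "x < c" | "x = c" | "c < x" by linarith
        then show "\<exists>V. open V \<and> x \<in> V \<and> C_on (enat p) k V"
        proof cases
          case 1
          have "C_on (enat p) k (A \<inter> {..<c})"
            by (rule C_on_cong[of _ "ls ! i"]) (use A C_on_subset[OF Cl] in \<open>auto simp: i(2)\<close>)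
          then show ?thesis using 1 x A c by (intro exI[of _ "A \<inter> {..<c}"]) (auto simp: I'_def)
        next
          case 2
          have "C_on (enat p) k V"
            by (rule C_on_cong[of _ "ls ! i"]) (use V C_on_subset[OF Cl] same i in auto)
          then show ?thesis using 2 V by blast
        next
          case 3
          have "C_on (enat p) k (B \<inter> {c<..})"
            by (rule C_on_cong[of _ "ms ! i"]) (use B C_on_subset[OF Cm] in \<open>auto simp: i(2)\<close>)
          then show ?thesis using 3 x B c by (intro exI[of _ "B \<inter> {c<..}"]) (auto simp: I'_def)
        qed
      qed
    qed
    moreover have "P t = linear_product (map (\<lambda>k. k t) ks)" if t: "t \<in> I'" for t
    proof (cases "t \<le> c")
      case True
      then have "map (\<lambda>k. k t) ks = map (\<lambda>l. l t) ls"
        unfolding ks_def by (intro nth_equalityI) auto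
      moreover have "t \<in> A" using True t c by (auto simp: I'_def)
      ultimately show ?thesis using ls(2) by simp
    next
      case False
      then have "map (\<lambda>k. k t) ks = map (\<lambda>l. l t) ms"
        unfolding ks_def using len by (intro nth_equalityI) auto
      moreover have "t \<in> B" using False t c by (auto simp: I'_def)
      ultimately show ?thesis using msP by simp
    qed
    ultimately show ?thesis unfolding C_roots_on_def by blast
  qed
  ultimately show ?thesis by (intro exI[of _ I'] conjI I'_def)
qed

lemma C_roots_on_subset: "C_roots_on p U P \<Longrightarrow> V \<subseteq> U \<Longrightarrow> C_roots_on p V P"
  unfolding C_roots_on_def using C_on_subset[of "enat p" _ U V] by (meson subsetD)

text \<open>
  Bolzano's bisection principle for the property that $C^p$ roots exist in a neighbourhood of
  \<open>{u..v}\<close>. Neighbourhoods of \<open>{u..v}\<close> and \<open>{v..w}\<close> both contain points \<open>c\<close> close to \<open>v\<close>, and if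
  $c \ne v$ the gluing lemma applies at \<open>c\<close>, even though the number of distinct roots may drop at \<open>v\<close>.
\<close>

lemma glue_over_compact_interval:
  assumes I: "open I" and ab: "a \<le> b" "{a..b} \<subseteq> I"
    and local: "\<And>t. t \<in> {a..b} \<Longrightarrow> C_roots_near p t P"
    and const: "\<And>t. t \<in> {a..b} \<Longrightarrow> \<exists>L. \<forall>\<^sub>F u in at t. card (real_roots (P u)) = L"
  shows "\<exists>I'. open I' \<and> is_interval I' \<and> {a..b} \<subseteq> I' \<and> I' \<subseteq> I \<and> C_roots_on p I' P"
proof -
  define good where "good u v \<longleftrightarrow> a \<le> u \<and> v \<le> b \<longrightarrow>
    (\<exists>I'. open I' \<and> is_interval I' \<and> {u..v} \<subseteq> I' \<and> I' \<subseteq> I \<and> C_roots_on p I' P)" for u v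
  have "good a b"
    using ab(1)
  proof (induction rule: Bolzano)
    case (trans u v w)
    show ?case
      unfolding good_def
    proof
      assume uw: "a \<le> u \<and> w \<le> b"
      obtain A where A: "open A" "is_interval A" "{u..v} \<subseteq> A" "A \<subseteq> I" "C_roots_on p A P"
        using trans uw unfolding good_def by force
      obtain B where B: "open B" "is_interval B" "{v..w} \<subseteq> B" "B \<subseteq> I" "C_roots_on p B P"
        using trans uw unfolding good_def by force
      obtain L where L: "\<forall>\<^sub>F t in at v. card (real_roots (P t)) = L"
        using const[of v] trans uw by auto
      have "v \<in> A \<inter> B" using A(3) B(3) trans by auto
      then have "\<forall>\<^sub>F t in at v. t \<in> A \<inter> B"
        using A(1) B(1) by (intro eventually_at_nhdsI eventually_nhds_open) auto
      then have "\<forall>\<^sub>F t in at v. t \<in> A \<inter> B \<and> card (real_roots (P t)) = L"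
        using L by (rule eventually_conj)
      then obtain W where W: "open W" "v \<in> W"
          "\<And>t. t \<in> W \<Longrightarrow> t \<noteq> v \<Longrightarrow> t \<in> A \<inter> B \<and> card (real_roots (P t)) = L"
        unfolding eventually_at_topological by auto
      obtain e where e: "e > 0" "ball v e \<subseteq> W" using W(1,2) openE by blast
      define c where "c = v + e / 2"
      have c: "c \<in> W" "c \<noteq> v" using e by (auto simp: c_def dist_real_def subset_eq)
      have "\<forall>\<^sub>F t in nhds c. t \<in> W - {v}"
        using W(1) c by (intro eventually_nhds_open) auto
      then have cL: "\<forall>\<^sub>F t in nhds c. card (real_roots (P t)) = L"
        by eventually_elim (use W(3) in auto)
      have cAB: "c \<in> A" "c \<in> B" using W(3)[OF c] by auto
      obtain I' where I': "open I'" "is_interval I'" "I' = (A \<inter> {..c}) \<union> (B \<inter> {c..})" "C_roots_on p I' P"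
        using glue_C_roots[OF A(1,2) B(1,2) cAB A(5) B(5) cL] by blast
      have "{u..w} \<subseteq> I'"
      proof
        fix t assume t: "t \<in> {u..w}"
        have uA: "u \<in> A" and wB: "w \<in> B" using A(3) B(3) trans by auto
        show "t \<in> I'"
        proof (cases "t \<le> c")
          case True
          then have "t \<in> A" using t by (intro mem_is_interval_1_I[OF A(2) uA cAB(1)]) auto
          then show ?thesis using True by (simp add: I'(3))
        next
          case False
          then have "t \<in> B" using t by (intro mem_is_interval_1_I[OF B(2) cAB(2) wB]) auto
          then show ?thesis using False by (simp add: I'(3))
        qed
      qed
      then show "\<exists>I'. open I' \<and> is_interval I' \<and> {u..w} \<subseteq> I' \<and> I' \<subseteq> I \<and> C_roots_on p I' P"
        using I' A(4) B(4) by blast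
    qed
  next
    case (local t)
    then obtain U where U: "open U" "t \<in> U" "C_roots_on p U P"
      using assms(4)[of t] unfolding C_roots_near_def by auto
    have "open (U \<inter> I)" "t \<in> U \<inter> I" using U I ab local by auto
    then obtain e where e: "e > 0" "ball t e \<subseteq> U \<inter> I" using openE by blast
    have "C_roots_on p (ball t e) P"
      using U(3) by (rule C_roots_on_subset) (use e(2) in auto)
    moreover have "is_interval (ball t e)" by (simp add: is_interval_ball_real)
    ultimately have "good u v" if "u \<le> t" "t \<le> v" "v - u < e" for u v
      unfolding good_def using that e(2)
      by (intro impI exI[of _ "ball t e"]) (auto simp: dist_real_def)
    then show ?case using e(1) by blast
  qed
  then show ?thesis by (simp add: good_def)
qed

section \<open>Roots near a compact interval\<close>

theorem theorem5p5:
  fixes I J :: "real set" and n p :: nat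
    and a :: "nat \<Rightarrow> real \<Rightarrow> real" and P :: "real \<Rightarrow> real poly"
  assumes I: "open I" "is_interval I"
    and P_eq: "\<And>t. t \<in> I \<Longrightarrow> P t = monom 1 n + (\<Sum>j=1..n. monom ((-1) ^ j * a j t) (n - j))"
    and P_curve: "hyperbolic_curve_on I n P"
    and E_empty: "E_infinity I P = {}"
    and J: "compact J" "is_interval J" "J \<noteq> {}" "J \<subseteq> I"
    and p: "p > 0"
    and Gamma_defined: "\<And>t0. t0 \<in> J \<Longrightarrow> Gamma_defined_at t0 P"
    and a_smooth: "\<And>j. j \<in> {1..n} \<Longrightarrow> C_on (enat p + Gamma_on J P) (a j) I"
  shows "\<exists>I' l. open I' \<and> is_interval I' \<and> J \<subseteq> I' \<and> I' \<subseteq> I \<and>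
           (\<forall>j\<in>{1..n}. C_on (enat p) (l j) I') \<and>
           (\<forall>t\<in>I'. \<forall>x. poly (P t) x = (\<Prod>j=1..n. x - l j t))"
proof -
  have local: "C_roots_near p t0 P \<and> (\<exists>L. \<forall>\<^sub>F t in at t0. card (real_roots (P t)) = L)"
    if t0: "t0 \<in> J" for t0
  proof -
    obtain G g where G: "Gamma_gamma t0 P G g"
      using Gamma_defined[OF t0] unfolding Gamma_defined_at_def by blast
    then have "enat G \<le> Gamma_on J P"
      unfolding Gamma_on_def using t0 by (intro Sup_upper) blast
    then have le: "enat (p + G) \<le> enat p + Gamma_on J P"
      by (simp add: add_left_mono flip: plus_enat_simps(1))
    have a_C: "C_on (enat (p + G)) (a j) I" if "j \<in> {1..n}" for j
      using a_smooth[OF that] le by (rule C_on_mono)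
    have "C_on (enat (p + G)) (\<lambda>t. coeff (P t) i) I" for i
    proof (rule C_on_cong[OF I(1)])
      have "C_on (enat (p + G)) (\<lambda>t. if n - j = i then (-1) ^ j * a j t else 0) I" if "j \<in> {1..n}" for j
        using I(1) by (cases "n - j = i") (auto intro!: C_on_mult C_on_const a_C[OF that])
      then show "C_on (enat (p + G)) (\<lambda>t. (if n = i then 1 else 0) +
          (\<Sum>j=1..n. if n - j = i then (-1) ^ j * a j t else 0)) I"
        by (intro C_on_add C_on_const C_on_sum I(1))
      show "(if n = i then 1 else 0) + (\<Sum>j=1..n. if n - j = i then (-1) ^ j * a j t else 0) = coeff (P t) i"
        if "t \<in> I" for t
        using P_eq[OF that] by (simp add: coeff_sum)
    qed
    then have "C_coeffs_near (enat (p + G)) t0 P"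
      unfolding C_coeffs_near_def using I(1) t0 J(4) by blast
    then obtain L where L: "root_dichotomy p L t0 P"
      using Gamma_gamma_imp_root_dichotomy[OF G] by blast
    have few: "\<not> (\<exists>\<^sub>F t in at t0. L < card (real_roots (P t)))"
      by (rule no_extra_roots[OF I(1) _ P_curve]) (use t0 J(4) E_empty L in \<open>auto simp: root_dichotomy_def\<close>)
    then have "\<forall>\<^sub>F t in at t0. \<not> L < card (real_roots (P t))"
      by (simp add: not_frequently)
    moreover have "\<forall>\<^sub>F t in at t0. L \<le> card (real_roots (P t))"
      using L by (simp add: root_dichotomy_def)
    ultimately have "\<forall>\<^sub>F t in at t0. card (real_roots (P t)) = L"
      by eventually_elim simp
    moreover have "C_roots_near p t0 P" using L few by (simp add: root_dichotomy_def)
    ultimately show ?thesis by blast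
  qed
  obtain x y where J_eq: "J = {x..y}"
    using J(1,2) is_interval_compact[of J] by (auto simp: cbox_interval)
  have "x \<le> y" using J(3) J_eq by simp
  then obtain I' where I': "open I'" "is_interval I'" "J \<subseteq> I'" "I' \<subseteq> I" "C_roots_on p I' P"
    using glue_over_compact_interval[OF I(1), of x y p P] local J(4) unfolding J_eq by blast
  then obtain ls where ls: "\<And>l. l \<in> set ls \<Longrightarrow> C_on (enat p) l I'"
      "\<And>t. t \<in> I' \<Longrightarrow> P t = linear_product (map (\<lambda>l. l t) ls)"
    unfolding C_roots_on_def by blast
  have len: "length ls = n"
  proof -
    obtain t where t: "t \<in> I'" using I'(3) J(3) by blast
    then have "degree (P t) = n" using P_curve I'(4) unfolding hyperbolic_curve_on_def by blast
    then show ?thesis using ls(2)[OF t] by (simp add: degree_linear_product)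
  qed
  show ?thesis
  proof (intro exI[of _ I'] exI[of _ "\<lambda>j. ls ! (j - 1)"] conjI ballI allI)
    fix j assume "j \<in> {1..n}"
    then show "C_on (enat p) (ls ! (j - 1)) I'" using ls(1) len by auto
  next
    fix t x assume t: "t \<in> I'"
    have "poly (P t) x = (\<Prod>l\<leftarrow>ls. x - l t)"
      by (simp add: ls(2)[OF t] poly_linear_product comp_def)
    also have "\<dots> = (\<Prod>i<n. x - (ls ! i) t)"
      using prod.list_conv_set_nth[of "map (\<lambda>l. x - l t) ls"] len by (simp add: atLeast0LessThan)
    also have "\<dots> = (\<Prod>j=1..n. x - (ls ! (j - 1)) t)"
      by (rule prod.reindex_bij_witness[of _ "\<lambda>j. j - 1" Suc]) auto
    finally show "poly (P t) x = (\<Prod>j=1..n. x - (ls ! (j - 1)) t)" .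
  qed (use I' in auto)
qed

end
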